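(* If $\mathcal Q$ is vertically bounded, then $B=\{0\}\cup B^{ct}$.
   Context: Let $(K,v)$ be a valued field, $\Gamma$ the divisible hull of $vK$, embedded in a divisible ordered abelian group $\Lambda$. Let $\nu\colon K[x]\to\Lambda\cup\{\infty\}$ be a valuation extending $v$ which is well-specified, i.e. it is not the case that simultaneously $\nu^{-1}(\infty)=0$, the value group of $\nu$ modulo $\Gamma$ is torsion, and the residue field of $\nu$ is algebraic over that of $v$. For $s\ge0$ let $\partial_s$ be the $s$-th Hasse–Schmidt derivative, defined by $f(x+y)=\sum_{s\ge0}(\partial_sf)y^s$. For nonconstant $f$ with $\nu(f)<\infty$ the level is $\epsilon_\nu(f)=\max\{(\nu(f)-\nu(\partial_sf))/s: s\ge1\}$; $\epsilon_\nu(a)=-\infty$ for $a\in K$. A monic $Q\in K[x]$ is a key polynomial for $\nu$ if $\epsilon_\nu(f)<\epsilon_\nu(Q)$ whenever $\deg f<\deg Q$. For monic $Q$, each $f$ has a unique $Q$-expansion $f=\sum_{i\ge0}f_{Q,i}Q^i$ with $\deg f_{Q,i}<\deg Q$; set $\nu_Q(f)=\min_i\nu(f_{Q,i}Q^i)$. Fix $m\ge1$ such that the set $\Psi_m$ of key polynomials of degree $m$ for $\nu$ is nonempty and has no element of maximal $\nu$-value. Let $\mathcal Q\subseteq\Psi_m$ be well-ordered by $Q<R\iff\nu(Q)<\nu(R)$ and cofinal in $\Psi_m$ for $\nu$-values; write $\gamma_Q=\nu(Q)$. As in the paper, all values $\nu_Q(f)$ ($f\ne0$) lie in $\Gamma$.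 "For all $Q$ large enough" means for all $Q$ in a final segment of $\mathcal Q$; a family indexed by $\mathcal Q$ is ultimately constant if it is constant on a final segment. $f$ is $\mathcal Q$-stable if $\nu_Q(f)=\nu(f)$ for all $Q$ large enough, $\mathcal Q$-unstable otherwise. Assume unstable polynomials exist; limit key polynomials are the monic $\mathcal Q$-unstable polynomials of minimal degree, forming $\mathrm{KP}_\infty(\mathcal Q)$. Fix $F\in\mathrm{KP}_\infty(\mathcal Q)$, $D=\lfloor\deg F/m\rfloor$, $F=\sum_{\ell=0}^DF_{Q,\ell}Q^\ell$, $\beta_{Q,\ell}=\nu(F_{Q,\ell})\in\Gamma\cup\{\infty\}$. Let $\delta^L$ be the smallest initial segment of $\Gamma$ containing $\{\nu_Q(F):Q\in\mathcal Q\}$; write $x>\delta^L$ if $x\in(\Gamma\setminus\delta^L)\cup\{\infty\}$. Let $J$ be the set of $\ell\in\{0,\dots,D\}$ with $\beta_{Q,\ell}+\ell\gamma_Q>\delta^L$ for all $Q$ large enough, $B=\{0,\dots,D\}\setminus J$, and $B^{ct}$ the set of $\ell\in B$ for which $(\beta_{Q,\ell})_{Q}$ is ultimately constant. A cut $\eta=(\eta^L,\eta^R)$ of $\Gamma$ is vertically bounded if for every $x\in\eta^L$ and rational $q>1$ there is $y\in\eta^L$ with $q(y-x)>z-x$ for all $z\in\eta^L$. Let $\gamma_{\mathcal Q}$ be the cut of $\Gamma$ whose lower set is the smallest initial segment containing $\{\gamma_Q:Q\in\mathcal Q\}$; $\mathcal Q$ is vertically bounded if $\gamma_{\mathcal Q}$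 is. *)

theory Defs
  imports "HOL-Computational_Algebra.Polynomial" "HOL-Library.Extended"
begin

primrec nmul :: "nat \<Rightarrow> 'a::monoid_add \<Rightarrow> 'a" where
  "nmul 0 x = 0"
| "nmul (Suc n) x = x + nmul n x"

definition zmul :: "int \<Rightarrow> 'a::group_add \<Rightarrow> 'a" where
  "zmul k x = (if 0 \<le> k then nmul (nat k) x else - nmul (nat (- k)) x)"

text \<open>Rational multiple q x: the unique y with (denominator q) y = (numerator q) x
  (unique in a torsion-free group, exists in a divisible one).\<close>
definition qmul :: "rat \<Rightarrow> 'a::linordered_ab_group_add \<Rightarrow> 'a" where
  "qmul q x = (THE y. nmul (nat (snd (quotient_of q))) y = zmul (fst (quotient_of q)) x)"

definition divisible_group :: "'a::linordered_ab_group_add itself \<Rightarrow> bool" where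
  "divisible_group _ \<longleftrightarrow> (\<forall>n::nat. \<forall>x::'a. 0 < n \<longrightarrow> (\<exists>y. nmul n y = x))"

text \<open>Values in \<open>\<Lambda> \<union> {\<infinity>}\<close> are modelled in \<open>'g extended\<close>, never taking the value \<open>Minf\<close>.\<close>

definition field_valuation :: "('k::field \<Rightarrow> 'g::linordered_ab_group_add extended) \<Rightarrow> bool" where
  "field_valuation v \<longleftrightarrow>
     (\<forall>a. v a \<noteq> Minf) \<and> (\<forall>a. v a = Pinf \<longleftrightarrow> a = 0) \<and>
     (\<forall>a b. v (a * b) = v a + v b) \<and> (\<forall>a b. min (v a) (v b) \<le> v (a + b))"

definition value_group :: "('k::field \<Rightarrow> 'g::linordered_ab_group_add extended) \<Rightarrow> 'g set" where
  "value_group v = {x. \<exists>a. a \<noteq> 0 \<and> v a = Fin x}"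

definition div_hull :: "('k::field \<Rightarrow> 'g::linordered_ab_group_add extended) \<Rightarrow> 'g set" where
  "div_hull v = {x. \<exists>n::nat. 0 < n \<and> nmul n x \<in> value_group v}"

text \<open>A valuation on \<open>K[x]\<close> (possibly with nonzero support) extending \<open>v\<close>.\<close>
definition poly_valuation ::
  "('k::field \<Rightarrow> 'g::linordered_ab_group_add extended) \<Rightarrow> ('k poly \<Rightarrow> 'g extended) \<Rightarrow> bool" where
  "poly_valuation v \<nu> \<longleftrightarrow>
     (\<forall>f. \<nu> f \<noteq> Minf) \<and>
     (\<forall>f g. \<nu> (f * g) = \<nu> f + \<nu> g) \<and>
     (\<forall>f g. min (\<nu> f) (\<nu> g) \<le> \<nu> (f + g)) \<and>
     (\<forall>a. \<nu> [:a:] = v a)"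

text \<open>The residue field of \<open>\<nu>\<close> is algebraic over that of \<open>v\<close>: every residue class of
  \<open>f/g\<close> (with \<open>\<nu> g < \<infinity>\<close>, \<open>\<nu> f \<ge> \<nu> g\<close>) is a root of a nonzero polynomial
  \<open>\<Sum> c_i T^i\<close> over the residue field of \<open>v\<close> (\<open>v(c_i) \<ge> 0\<close>, some \<open>v(c_i) = 0\<close>).\<close>
definition residue_algebraic ::
  "('k::field \<Rightarrow> 'g::linordered_ab_group_add extended) \<Rightarrow> ('k poly \<Rightarrow> 'g extended) \<Rightarrow> bool" where
  "residue_algebraic v \<nu> \<longleftrightarrow>
     (\<forall>f g. \<nu> g \<noteq> Pinf \<and> \<nu> g \<le> \<nu> f \<longrightarrow>
        (\<exists>n::nat. \<exists>c::nat \<Rightarrow> 'k.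
           (\<forall>i\<le>n. 0 \<le> v (c i)) \<and> (\<exists>i\<le>n. v (c i) = 0) \<and>
           \<nu> (g ^ n) < \<nu> (\<Sum>i\<le>n. [:c i:] * f ^ i * g ^ (n - i))))"

definition value_group_torsion_mod ::
  "('k::field \<Rightarrow> 'g::linordered_ab_group_add extended) \<Rightarrow> ('k poly \<Rightarrow> 'g extended) \<Rightarrow> bool" where
  "value_group_torsion_mod v \<nu> \<longleftrightarrow>
     (\<forall>f g a b. \<nu> f = Fin a \<and> \<nu> g = Fin b \<longrightarrow>
        (\<exists>n::nat. 0 < n \<and> nmul n (a - b) \<in> div_hull v))"

definition well_specified ::
  "('k::field \<Rightarrow> 'g::linordered_ab_group_add extended) \<Rightarrow> ('k poly \<Rightarrow> 'g extended) \<Rightarrow> bool" where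
  "well_specified v \<nu> \<longleftrightarrow>
     \<not> ({f. \<nu> f = Pinf} = {0} \<and> value_group_torsion_mod v \<nu> \<and> residue_algebraic v \<nu>)"

text \<open>\<open>\<partial>_s f\<close> is the coefficient of \<open>y^s\<close> in \<open>f(x+y) \<in> K[x][y]\<close>.\<close>
definition hasse :: "nat \<Rightarrow> 'k::field poly \<Rightarrow> 'k poly" where
  "hasse s f = coeff (pcompose (map_poly (\<lambda>c. [:c:]) f) [: [:0, 1:], 1 :]) s"

text \<open>Level of a nonconstant polynomial: \<open>max {(\<nu> f - \<nu>(\<partial>_s f))/s : s \<ge> 1}\<close>
  (terms with \<open>\<nu>(\<partial>_s f) = \<infinity>\<close> contribute \<open>-\<infinity>\<close> and are omitted); it is \<open>\<infinity>\<close> if \<open>\<nu> f = \<infinity>\<close>.\<close>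
definition level :: "('k::field poly \<Rightarrow> 'g::linordered_ab_group_add extended) \<Rightarrow> 'k poly \<Rightarrow> 'g extended" where
  "level \<nu> f = (case \<nu> f of
      Fin a \<Rightarrow> Fin (Max {qmul (1 / of_nat s) (a - b) | s b. 1 \<le> s \<and> \<nu> (hasse s f) = Fin b})
    | _ \<Rightarrow> Pinf)"

text \<open>Key polynomial: monic, and \<open>\<epsilon>(f) < \<epsilon>(Q)\<close> whenever \<open>deg f < deg Q\<close>
  (for constant \<open>f\<close> this is \<open>-\<infinity> < \<epsilon>(Q)\<close>, automatic since then \<open>Q\<close> is nonconstant).\<close>
definition key_poly :: "('k::field poly \<Rightarrow> 'g::linordered_ab_group_add extended) \<Rightarrow> 'k poly \<Rightarrow> bool" where
  "key_poly \<nu> Q \<longleftrightarrow> lead_coeff Q = 1 \<and>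
     (\<forall>f. 0 < degree f \<and> degree f < degree Q \<longrightarrow> level \<nu> f < level \<nu> Q)"

definition Psi :: "('k::field poly \<Rightarrow> 'g::linordered_ab_group_add extended) \<Rightarrow> nat \<Rightarrow> 'k poly set" where
  "Psi \<nu> m = {Q. key_poly \<nu> Q \<and> degree Q = m}"

primrec exp_coeff :: "'k::field poly \<Rightarrow> 'k poly \<Rightarrow> nat \<Rightarrow> 'k poly" where
  "exp_coeff Q f 0 = f mod Q"
| "exp_coeff Q f (Suc i) = exp_coeff Q (f div Q) i"

definition nuQ :: "('k::field poly \<Rightarrow> 'g::linordered_ab_group_add extended) \<Rightarrow> 'k poly \<Rightarrow> 'k poly \<Rightarrow> 'g extended" where
  "nuQ \<nu> Q f = Min ((\<lambda>i. \<nu> (exp_coeff Q f i * Q ^ i)) ` {..degree f})"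

definition eventually_Q :: "('k::field poly \<Rightarrow> 'g::linordered_ab_group_add extended) \<Rightarrow> 'k poly set \<Rightarrow> ('k poly \<Rightarrow> bool) \<Rightarrow> bool" where
  "eventually_Q \<nu> QQ P \<longleftrightarrow> (\<exists>Q0\<in>QQ. \<forall>Q\<in>QQ. \<nu> Q0 \<le> \<nu> Q \<longrightarrow> P Q)"

definition ult_constant :: "('k::field poly \<Rightarrow> 'g::linordered_ab_group_add extended) \<Rightarrow> 'k poly set \<Rightarrow> ('k poly \<Rightarrow> 'b) \<Rightarrow> bool" where
  "ult_constant \<nu> QQ h \<longleftrightarrow> (\<exists>c. eventually_Q \<nu> QQ (\<lambda>Q. h Q = c))"

definition Q_stable :: "('k::field poly \<Rightarrow> 'g::linordered_ab_group_add extended) \<Rightarrow> 'k poly set \<Rightarrow> 'k poly \<Rightarrow> bool" where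
  "Q_stable \<nu> QQ f \<longleftrightarrow> eventually_Q \<nu> QQ (\<lambda>Q. nuQ \<nu> Q f = \<nu> f)"

definition KP_inf :: "('k::field poly \<Rightarrow> 'g::linordered_ab_group_add extended) \<Rightarrow> 'k poly set \<Rightarrow> 'k poly set" where
  "KP_inf \<nu> QQ = {F. lead_coeff F = 1 \<and> \<not> Q_stable \<nu> QQ F \<and>
                     (\<forall>g. \<not> Q_stable \<nu> QQ g \<longrightarrow> degree F \<le> degree g)}"

definition deltaL ::
  "('k::field \<Rightarrow> 'g::linordered_ab_group_add extended) \<Rightarrow> ('k poly \<Rightarrow> 'g extended) \<Rightarrow> 'k poly set \<Rightarrow> 'k poly \<Rightarrow> 'g set" where
  "deltaL v \<nu> QQ F = {x \<in> div_hull v. \<exists>Q\<in>QQ. Fin x \<le> nuQ \<nu> Q F}"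

definition above_deltaL ::
  "('k::field \<Rightarrow> 'g::linordered_ab_group_add extended) \<Rightarrow> ('k poly \<Rightarrow> 'g extended) \<Rightarrow> 'k poly set \<Rightarrow> 'k poly \<Rightarrow> 'g extended \<Rightarrow> bool" where
  "above_deltaL v \<nu> QQ F x \<longleftrightarrow>
     x = Pinf \<or> (\<exists>y. x = Fin y \<and> y \<in> div_hull v \<and> y \<notin> deltaL v \<nu> QQ F)"

definition J_set ::
  "('k::field \<Rightarrow> 'g::linordered_ab_group_add extended) \<Rightarrow> ('k poly \<Rightarrow> 'g extended) \<Rightarrow> nat \<Rightarrow> 'k poly set \<Rightarrow> 'k poly \<Rightarrow> nat set" where
  "J_set v \<nu> m QQ F = {l \<in> {0..degree F div m}.
      eventually_Q \<nu> QQ (\<lambda>Q. above_deltaL v \<nu> QQ F (\<nu> (exp_coeff Q F l) + nmul l (\<nu> Q)))}"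

definition B_set ::
  "('k::field \<Rightarrow> 'g::linordered_ab_group_add extended) \<Rightarrow> ('k poly \<Rightarrow> 'g extended) \<Rightarrow> nat \<Rightarrow> 'k poly set \<Rightarrow> 'k poly \<Rightarrow> nat set" where
  "B_set v \<nu> m QQ F = {0..degree F div m} - J_set v \<nu> m QQ F"

definition Bct_set ::
  "('k::field \<Rightarrow> 'g::linordered_ab_group_add extended) \<Rightarrow> ('k poly \<Rightarrow> 'g extended) \<Rightarrow> nat \<Rightarrow> 'k poly set \<Rightarrow> 'k poly \<Rightarrow> nat set" where
  "Bct_set v \<nu> m QQ F = {l \<in> B_set v \<nu> m QQ F. ult_constant \<nu> QQ (\<lambda>Q. \<nu> (exp_coeff Q F l))}"

text \<open>A cut of \<open>\<Gamma>\<close> given by its lower set \<open>L\<close>.\<close>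
definition vert_bounded :: "'g::linordered_ab_group_add set \<Rightarrow> bool" where
  "vert_bounded L \<longleftrightarrow>
     (\<forall>x\<in>L. \<forall>q::rat. 1 < q \<longrightarrow> (\<exists>y\<in>L. \<forall>z\<in>L. z - x < qmul q (y - x)))"

definition gammaL ::
  "('k::field \<Rightarrow> 'g::linordered_ab_group_add extended) \<Rightarrow> ('k poly \<Rightarrow> 'g extended) \<Rightarrow> 'k poly set \<Rightarrow> 'g set" where
  "gammaL v \<nu> QQ = {x \<in> div_hull v. \<exists>Q\<in>QQ. Fin x \<le> \<nu> Q}"

end

theory Submission
  imports Defs
begin

text \<open>
  Write \<open>\<gamma>\<^sub>Q = \<nu>(Q)\<close>. If \<open>Q < R\<close> then \<open>R - Q\<close> has degree below \<open>m\<close> and value \<open>\<gamma>\<^sub>Q\<close>, so \<open>\<nu>\<^sub>Q\<close> can also be computed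
  from \<open>R\<close>-expansions by giving \<open>R\<close> the weight \<open>\<gamma>\<^sub>Q\<close>. Fix \<open>P < Q0\<close> and let \<open>D\<^sub>l F\<close> be the \<open>l\<close>-th divided
  derivative of \<open>F\<close> with respect to the formal variable \<open>Q0\<close>. For \<open>Q > Q0\<close> the coefficient \<open>F\<^sub>Q\<^sub>,\<^sub>l\<close> agrees
  with \<open>D\<^sub>l F mod Q\<close> up to carries, whose contribution to the \<open>l\<close>-th term of the expansion has value at least
  \<open>\<nu>\<^sub>Q\<^sub>0(F) + \<gamma>\<^sub>Q - \<gamma>\<^sub>P\<close>. On the other hand \<open>\<nu>\<^sub>R(F) \<le> \<nu>\<^sub>Q\<^sub>0(F) + (deg F div m) (\<gamma>\<^sub>R - \<gamma>\<^sub>Q\<^sub>0)\<close>, and vertical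
  boundedness yields \<open>Q0\<close> for which this stays below the carries for all \<open>R\<close>. For \<open>l \<ge> 1\<close> the polynomial
  \<open>D\<^sub>l F\<close> has smaller degree than \<open>F\<close>, hence is stable and its residues modulo \<open>Q\<close> have ultimately constant
  value; this value is that of \<open>F\<^sub>Q\<^sub>,\<^sub>l\<close> unless the \<open>l\<close>-th term lies above \<open>\<delta>\<^sup>L\<close>. Finally \<open>0 \<in> B\<close>, since otherwise
  \<open>F = F\<^sub>Q\<^sub>,\<^sub>0 + Q G\<close> with \<open>G\<close> stable forces \<open>\<nu>\<^sub>R(F) \<ge> min (\<nu>(F)) (\<nu>(F\<^sub>Q\<^sub>,\<^sub>0))\<close> for some \<open>R\<close>,
  although both of these values exceed \<open>\<nu>\<^sub>R(F)\<close>.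
\<close>

section \<open>Multiples in ordered abelian groups\<close>

lemma nmul_add_left: "nmul (i + j) x = nmul i x + nmul j x"
  for x :: "'a::comm_monoid_add"
  by (induction i) (auto simp: algebra_simps)

lemma nmul_add: "nmul n (x + y) = nmul n x + nmul n y"
  for x y :: "'a::comm_monoid_add"
  by (induction n) (auto simp: algebra_simps)

lemma nmul_minus: "nmul n (- x) = - nmul n x"
  for x :: "'a::ab_group_add"
  by (induction n) (auto simp: algebra_simps)

lemma nmul_diff: "nmul n (x - y) = nmul n x - nmul n y"
  for x y :: "'a::ab_group_add"
  using nmul_add[of n x "- y"] by (simp add: nmul_minus)

lemma nmul_zero [simp]: "nmul n (0::'a::monoid_add) = 0"
  by (induction n) auto

lemma nmul_mult: "nmul (i * j) x = nmul i (nmul j x)"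
  for x :: "'a::comm_monoid_add"
  by (induction i) (auto simp: nmul_add_left)

lemma nmul_mono: "x \<le> y \<Longrightarrow> nmul n x \<le> nmul n y"
  for x y :: "'a::linordered_ab_group_add"
  by (induction n) (auto intro: add_mono)

lemma nmul_strict_mono: "x < y \<Longrightarrow> 0 < n \<Longrightarrow> nmul n x < nmul n y"
  for x y :: "'a::linordered_ab_group_add"
proof (induction n)
  case (Suc n)
  then show ?case
    using nmul_mono[of x y n] by (auto intro: add_less_le_mono)
qed simp

lemma nmul_inject: "0 < n \<Longrightarrow> nmul n x = nmul n y \<longleftrightarrow> x = y"
  for x y :: "'a::linordered_ab_group_add"
  using nmul_strict_mono[of x y n] nmul_strict_mono[of y x n] by (metis less_irrefl neqE)

lemma nmul_mono_left: "0 \<le> x \<Longrightarrow> i \<le> j \<Longrightarrow> nmul i x \<le> nmul j x"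
  for x :: "'a::linordered_ab_group_add"
  using nmul_add_left[of i "j - i" x] nmul_mono[of 0 x "j - i"] by simp

lemma nmul_Fin: "nmul n (Fin x) = Fin (nmul n x)"
  for x :: "'a::comm_monoid_add"
  by (induction n) (auto simp: zero_extended_def)

text \<open>Divisibility supplies the solution that the definite description in \<open>qmul\<close>
  asks for, and torsion-freeness makes it unique. This lets levels be handled through multiples
  instead of quotients.\<close>

lemma nmul_qmul_inverse:
  fixes x :: "'g::linordered_ab_group_add"
  assumes "divisible_group TYPE('g)" "0 < s"
  shows "nmul s (qmul (1 / of_nat s) x) = x"
proof -
  have "quotient_of (1 / of_nat s) = (1, int s)"
    using quotient_of_Fract[of 1 "int s"] assms(2)
    by (simp add: Fract_of_int_quotient)
  then have "qmul (1 / of_nat s) x = (THE y. nmul s y = x)"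
    by (simp add: qmul_def zmul_def)
  moreover have "\<exists>!y. nmul s y = x"
    using assms nmul_inject[of s] unfolding divisible_group_def by metis
  ultimately show ?thesis
    using theI'[of "\<lambda>y. nmul s y = x"] by simp
qed

text \<open>Vertical boundedness will be applied with the ratio \<open>(n + 1) / n\<close>. It is in
  lowest terms, so \<open>quotient_of\<close> returns exactly this pair.\<close>

lemma nmul_qmul_Suc:
  fixes x :: "'g::linordered_ab_group_add"
  assumes "divisible_group TYPE('g)" "0 < n"
  shows "nmul n (qmul (of_nat (Suc n) / of_nat n) x) = nmul (Suc n) x"
proof -
  have "coprime (int (Suc n)) (int n)"
    by (metis coprime_Suc_left_nat coprime_int_iff)
  then have "quotient_of (of_nat (Suc n) / of_nat n) = (int (Suc n), int n)"
    using quotient_of_Fract[of "int (Suc n)" "int n"] assms(2)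
    by (simp add: Fract_of_int_quotient normalize_stable)
  then have "qmul (of_nat (Suc n) / of_nat n) x = (THE y. nmul n y = nmul (Suc n) x)"
    by (simp add: qmul_def zmul_def nat_add_distrib del: of_nat_Suc nmul.simps)
  moreover have "\<exists>!y. nmul n y = nmul (Suc n) x"
    using assms nmul_inject[of n] unfolding divisible_group_def by metis
  ultimately show ?thesis
    using theI'[of "\<lambda>y. nmul n y = nmul (Suc n) x"] by simp
qed

section \<open>Hasse derivatives\<close>

lemma map_poly_const_add:
  "map_poly (\<lambda>c. [:c:]) (f + g) = map_poly (\<lambda>c. [:c:]) f + map_poly (\<lambda>c. [:c:]) (g :: 'k::field poly)"
  by (intro poly_eqI) (simp add: coeff_map_poly)

lemma map_poly_const_mult:
  "map_poly (\<lambda>c. [:c:]) (f * g) = map_poly (\<lambda>c. [:c:]) f * map_poly (\<lambda>c. [:c:]) (g :: 'k::field poly)"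
proof -
  have "(\<Sum>i\<in>A. [:h i:]) = [:sum h A:]" for h :: "nat \<Rightarrow> 'k" and A
    by (induction A rule: infinite_finite_induct) auto
  then show ?thesis
    by (intro poly_eqI) (simp add: coeff_map_poly coeff_mult mult.commute)
qed

lemma hasse_add: "hasse s (f + g) = hasse s f + hasse s g"
  by (simp add: hasse_def map_poly_const_add pcompose_add)

lemma hasse_mult: "hasse s (f * g) = (\<Sum>i\<le>s. hasse i f * hasse (s - i) g)"
  by (simp add: hasse_def map_poly_const_mult pcompose_mult coeff_mult)

lemma hasse_0: "hasse 0 f = f"
  using pcompose_altdef[of f "[:0, 1:]"] by (simp add: hasse_def)

lemma hasse_eq_0:
  assumes "degree f < s"
  shows "hasse s f = 0"
proof -
  have "degree (pcompose (map_poly (\<lambda>c. [:c:]) f) [: [:0, 1:], 1 :]) = degree f"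
    by (simp add: degree_pcompose degree_map_poly)
  then show ?thesis
    using assms by (simp add: hasse_def coeff_eq_0)
qed

text \<open>For nonconstant \<open>f\<close> this derivative is a nonzero constant, hence of finite
  value, so the set whose maximum defines \<open>level\<close> is nonempty.\<close>

lemma hasse_degree: "hasse (degree f) f = [:lead_coeff f:]"
proof -
  let ?p = "pcompose (map_poly (\<lambda>c. [:c:]) f) [: [:0, 1:], 1 :]"
  have "degree ?p = degree f"
    by (simp add: degree_pcompose degree_map_poly)
  moreover have "lead_coeff ?p = [:lead_coeff f:]"
    by (subst lead_coeff_comp) (simp_all add: degree_map_poly coeff_map_poly)
  ultimately show ?thesis
    by (simp add: hasse_def)
qed

section \<open>Expansions in powers of a polynomial\<close>

lemma exp_coeff_add: "exp_coeff Q (f + g) i = exp_coeff Q f i + exp_coeff Q g i"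
  by (induction i arbitrary: f g) (auto simp: poly_mod_add_left poly_div_add_left)

lemma exp_coeff_minus: "exp_coeff Q (- f) i = - exp_coeff Q f i"
  by (induction i arbitrary: f) (auto simp: poly_mod_minus_left poly_div_minus_left)

lemma exp_coeff_diff: "exp_coeff Q (f - g) i = exp_coeff Q f i - exp_coeff Q g i"
  using exp_coeff_add[of Q f "- g" i] by (simp add: exp_coeff_minus)

lemma exp_coeff_0_left [simp]: "exp_coeff Q 0 i = 0"
  by (induction i) auto

lemma exp_coeff_small:
  "degree f < degree Q \<Longrightarrow> exp_coeff Q f i = (if i = 0 then f else 0)"
  by (cases i) (auto simp: mod_poly_less div_poly_less)

lemma degree_exp_coeff: "0 < degree Q \<Longrightarrow> degree (exp_coeff Q f i) < degree Q"
proof (induction i arbitrary: f)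
  case 0
  then show ?case
    by (metis degree_mod_less' degree_0 exp_coeff.simps(1) less_nat_zero_code)
qed simp

lemma exp_coeff_mult_self:
  assumes "Q \<noteq> 0"
  shows "exp_coeff Q (Q * f) 0 = 0" "exp_coeff Q (Q * f) (Suc i) = exp_coeff Q f i"
  using assms by auto

lemma degree_div_poly:
  fixes f Q :: "'k::field poly"
  assumes "0 < degree Q"
  shows "degree (f div Q) = degree f - degree Q"
proof (cases "degree f < degree Q")
  case True
  then show ?thesis by (simp add: div_poly_less)
next
  case False
  then have "f div Q \<noteq> 0"
    using assms by (metis degree_0 degree_mod_less' div_mult_mod_eq add_0 mult_zero_left
        not_less less_zeroE)
  then have dQ: "degree (f div Q * Q) = degree (f div Q) + degree Q"
    using assms by (intro degree_mult_eq) auto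
  moreover have "degree (f mod Q) < degree Q"
    using degree_exp_coeff[OF assms, of f 0] by simp
  ultimately have "degree (f div Q * Q + f mod Q) = degree (f div Q) + degree Q"
    by (subst degree_add_eq_left) auto
  then show ?thesis by simp
qed

lemma exp_coeff_eq_0: "degree f < i * degree Q \<Longrightarrow> exp_coeff Q f i = 0"
proof (induction i arbitrary: f)
  case (Suc i)
  show ?case
  proof (cases "degree f < degree Q")
    case True
    then show ?thesis by (simp add: div_poly_less)
  next
    case False
    then have "degree (f div Q) < i * degree Q"
      using Suc.prems degree_div_poly[of Q f] by (cases "degree Q = 0") auto
    then show ?thesis using Suc.IH by auto
  qed
qed simp

lemma mult_div_split:
  fixes a h Q :: "'k::field poly"
  assumes "Q \<noteq> 0"
  shows "(a * h) div Q = a * (h div Q) + (a * (h mod Q)) div Q"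
proof -
  have "a * h = a * (h mod Q) + a * (h div Q) * Q"
    by (metis add.commute distrib_left div_mult_mod_eq mult.assoc)
  then show ?thesis
    using assms by (metis div_mult_self1)
qed

lemma degree_mult_div_less:
  fixes f g Q :: "'k::field poly"
  assumes "degree f < degree Q" "degree g < degree Q"
  shows "degree ((f * g) div Q) < degree Q"
  using assms degree_mult_le[of f g] by (subst degree_div_poly) auto

text \<open>The digits of \<open>h\<close> are multiplied by \<open>a\<close> one at a time. The
  quotient of each product by \<open>Q\<close> has degree below \<open>degree Q\<close>, so it is
  itself a digit and is carried only into the next place.\<close>

lemma exp_coeff_mult_small:
  assumes "degree a < degree Q"
  shows "exp_coeff Q (a * h) (Suc l) =
    (a * exp_coeff Q h (Suc l)) mod Q + (a * exp_coeff Q h l) div Q"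
proof (induction l arbitrary: h)
  case 0
  have "degree ((a * (h mod Q)) div Q) < degree Q"
    using assms degree_exp_coeff[of Q h 0] by (intro degree_mult_div_less) auto
  moreover have "Q \<noteq> 0" using assms by auto
  ultimately show ?case
    by (simp add: mult_div_split[of Q a h] poly_mod_add_left mod_poly_less mod_mult_right_eq)
next
  case (Suc l)
  have "degree ((a * (h mod Q)) div Q) < degree Q"
    using assms degree_exp_coeff[of Q h 0] by (intro degree_mult_div_less) auto
  moreover have "Q \<noteq> 0" using assms by auto
  moreover have "exp_coeff Q (a * h) (Suc (Suc l)) = exp_coeff Q ((a * h) div Q) (Suc l)"
    by simp
  ultimately show ?case
    using Suc.IH[of "h div Q"]
    by (simp add: mult_div_split[of Q a h] exp_coeff_add exp_coeff_small del: exp_coeff.simps)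
      (simp add: poly_div_add_left div_poly_less)
qed

lemma degree_div_less:
  fixes f Q :: "'k::field poly"
  assumes "0 < degree Q" "degree Q \<le> degree f"
  shows "degree (f div Q) < degree f"
  using assms by (simp add: degree_div_poly)

text \<open>The \<open>l\<close>-th divided derivative of \<open>f\<close> with respect to the formal variable \<open>Q\<close>, computed by the
  Leibniz rule from \<open>f = f mod Q + Q * (f div Q)\<close>.\<close>

function exp_deriv :: "'k::field poly \<Rightarrow> nat \<Rightarrow> 'k poly \<Rightarrow> 'k poly" where
  "exp_deriv Q l f =
    (if l = 0 then f
     else if degree Q = 0 \<or> degree f < degree Q then 0
     else Q * exp_deriv Q l (f div Q) + exp_deriv Q (l - 1) (f div Q))"
  by pat_completeness auto
termination
  by (relation "measure (\<lambda>(Q, l, f). degree f)") (auto simp: degree_div_less)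

declare exp_deriv.simps [simp del]

lemma exp_deriv_0 [simp]: "exp_deriv Q 0 f = f"
  by (simp add: exp_deriv.simps)

lemma exp_deriv_Suc_small: "degree f < degree Q \<Longrightarrow> exp_deriv Q (Suc l) f = 0"
  by (simp add: exp_deriv.simps)

lemma exp_deriv_Suc:
  "0 < degree Q \<Longrightarrow> exp_deriv Q (Suc l) f =
     Q * exp_deriv Q (Suc l) (f div Q) + exp_deriv Q l (f div Q)"
  by (cases "degree f < degree Q"; cases l)
    (simp_all add: exp_deriv.simps[of Q "Suc _" f] exp_deriv_Suc_small div_poly_less)

text \<open>The drop in degree is what makes derivatives of positive order of a limit key polynomial
  stable. Zero is listed separately because \<open>degree 0 = 0\<close>.\<close>

lemma degree_exp_deriv:
  assumes "0 < degree Q"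
  shows "exp_deriv Q (Suc l) f = 0 \<or> degree (exp_deriv Q (Suc l) f) + degree Q \<le> degree f"
proof (induction "degree f" arbitrary: f l rule: less_induct)
  case less
  show ?case
  proof (cases "degree f < degree Q")
    case True
    then show ?thesis by (simp add: exp_deriv_Suc_small)
  next
    case False
    define h where "h = f div Q"
    have dh: "degree h + degree Q = degree f" "degree h < degree f"
      using False assms by (auto simp: h_def degree_div_poly)
    have "degree (Q * exp_deriv Q (Suc l) h) \<le> degree h"
      using less[OF dh(2), of l] degree_mult_le[of Q "exp_deriv Q (Suc l) h"] by auto
    moreover have "degree (exp_deriv Q l h) \<le> degree h"
      using less[OF dh(2), of "l - 1"] by (cases l) auto
    ultimately have "degree (exp_deriv Q (Suc l) f) \<le> degree h"
      by (simp add: exp_deriv_Suc[OF assms, of l f] degree_add_le flip: h_def)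
    then show ?thesis using dh by simp
  qed
qed

section \<open>Valuations on polynomial rings\<close>

lemma Fin_le_diff_cancel: "Fin (c - a) \<le> x \<longleftrightarrow> Fin c \<le> x + Fin a"
  for a c :: "'g::linordered_ab_group_add"
  by (cases x) (auto simp: algebra_simps)

lemma Fin_le_trans: "Fin a \<le> x \<Longrightarrow> b \<le> a \<Longrightarrow> Fin b \<le> x"
  for x :: "'g::linorder extended"
  by (cases x) auto

locale poly_val =
  fixes v :: "'k::field \<Rightarrow> 'g::linordered_ab_group_add extended"
    and \<nu> :: "'k poly \<Rightarrow> 'g extended"
  assumes divisible: "divisible_group TYPE('g)"
    and fv: "field_valuation v"
    and pv: "poly_valuation v \<nu>"
begin

lemma nu_not_Minf [simp]: "\<nu> f \<noteq> Minf"
  using pv by (simp add: poly_valuation_def)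

lemma nu_mult: "\<nu> (f * g) = \<nu> f + \<nu> g"
  using pv by (simp add: poly_valuation_def)

lemma nu_const: "\<nu> [:a:] = v a"
  using pv by (simp add: poly_valuation_def)

lemma nu_0 [simp]: "\<nu> 0 = Pinf"
  using nu_const[of 0] fv by (simp add: field_valuation_def)

lemma nu_const_finite: "a \<noteq> 0 \<Longrightarrow> \<nu> [:a:] \<noteq> Pinf"
  using fv by (simp add: nu_const field_valuation_def)

lemma nu_1 [simp]: "\<nu> 1 = Fin 0"
proof -
  have "\<nu> 1 \<noteq> Pinf"
    using nu_const_finite[of 1] by (simp add: one_pCons)
  moreover have "\<nu> 1 = \<nu> 1 + \<nu> 1"
    using nu_mult[of 1 1] by simp
  ultimately show ?thesis
    by (cases "\<nu> 1") auto
qed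

lemma nu_minus [simp]: "\<nu> (- f) = \<nu> f"
proof -
  have "\<nu> (- 1) + \<nu> (- 1) = Fin 0"
    using nu_mult[of "- 1" "- 1"] by simp
  then have "\<nu> (- 1) = Fin 0"
    by (cases "\<nu> (- 1)") (auto simp: double_zero)
  then show ?thesis
    using nu_mult[of "- 1" f] by (cases "\<nu> f") auto
qed

lemma nu_add: "min (\<nu> f) (\<nu> g) \<le> \<nu> (f + g)"
  using pv by (simp add: poly_valuation_def)

lemma nu_diff: "min (\<nu> f) (\<nu> g) \<le> \<nu> (f - g)"
  using nu_add[of f "- g"] by simp

lemma nu_add_ge: "x \<le> \<nu> f \<Longrightarrow> x \<le> \<nu> g \<Longrightarrow> x \<le> \<nu> (f + g)"
  using nu_add[of f g] by (meson min.boundedI order_trans)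

lemma nu_diff_ge: "x \<le> \<nu> f \<Longrightarrow> x \<le> \<nu> g \<Longrightarrow> x \<le> \<nu> (f - g)"
  using nu_diff[of f g] by (meson min.boundedI order_trans)

lemma nu_add_greater: "x < \<nu> f \<Longrightarrow> x < \<nu> g \<Longrightarrow> x < \<nu> (f + g)"
  using nu_add[of f g] by (meson min_less_iff_conj order_less_le_trans)

lemma nu_diff_greater: "x < \<nu> f \<Longrightarrow> x < \<nu> g \<Longrightarrow> x < \<nu> (f - g)"
  using nu_diff[of f g] by (meson min_less_iff_conj order_less_le_trans)

lemma nu_add_eq: "\<nu> f < \<nu> g \<Longrightarrow> \<nu> (f + g) = \<nu> f"
  using nu_add[of f g] nu_diff[of "f + g" g] by (auto simp: min_def split: if_splits)

lemma nu_mult_ge: "Fin a \<le> \<nu> f \<Longrightarrow> Fin b \<le> \<nu> g \<Longrightarrow> Fin (a + b) \<le> \<nu> (f * g)"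
  unfolding nu_mult by (cases "\<nu> f"; cases "\<nu> g") (auto intro: add_mono)

lemma nu_mult_greater: "Fin a < \<nu> f \<Longrightarrow> Fin b \<le> \<nu> g \<Longrightarrow> Fin (a + b) < \<nu> (f * g)"
  unfolding nu_mult by (cases "\<nu> f"; cases "\<nu> g") (auto intro: add_less_le_mono)

lemma nu_sum_greater: "(\<And>i. i \<in> A \<Longrightarrow> Fin x < \<nu> (f i)) \<Longrightarrow> Fin x < \<nu> (sum f A)"
  by (induction A rule: infinite_finite_induct) (auto intro: nu_add_greater)

lemma nu_power: "\<nu> f = Fin a \<Longrightarrow> \<nu> (f ^ n) = Fin (nmul n a)"
  by (induction n) (auto simp: nu_mult)

section \<open>Levels and key polynomials\<close>

text \<open>The quotients form a finite set, since derivatives beyond \<open>degree f\<close>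
  vanish, and a nonempty one, so the maximum \<open>e\<close> is attained at some order
  \<open>b\<close>. Multiples of \<open>e\<close> replace the division by the order.\<close>

lemma level_Fin:
  assumes "0 < degree f" "\<nu> f = Fin a"
  obtains e b where "level \<nu> f = Fin e" "1 \<le> b" "\<nu> (hasse b f) = Fin (a - nmul b e)"
    "\<And>s. 1 \<le> s \<Longrightarrow> Fin (a - nmul s e) \<le> \<nu> (hasse s f)"
proof -
  define S where "S = {qmul (1 / of_nat s) (a - b) | s b. 1 \<le> s \<and> \<nu> (hasse s f) = Fin b}"
  define e where "e = Max S"
  have lev: "level \<nu> f = Fin e"
    using assms(2) by (simp add: level_def e_def S_def)
  have "S \<subseteq> (\<lambda>s. qmul (1 / of_nat s) (a - (case \<nu> (hasse s f) of Fin b \<Rightarrow> b | _ \<Rightarrow> 0))) ` {1..degree f}"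
  proof
    fix x assume "x \<in> S"
    then obtain s b where sb: "x = qmul (1 / of_nat s) (a - b)" "1 \<le> s" "\<nu> (hasse s f) = Fin b"
      unfolding S_def by blast
    then have "s \<le> degree f"
      using hasse_eq_0[of f s] by (metis extended.distinct(1) not_less nu_0)
    with sb show "x \<in> (\<lambda>s. qmul (1 / of_nat s) (a - (case \<nu> (hasse s f) of Fin b \<Rightarrow> b | _ \<Rightarrow> 0))) ` {1..degree f}"
      by (intro image_eqI[of _ _ s]) auto
  qed
  then have fin: "finite S"
    by (rule finite_subset) simp
  have "\<nu> [:lead_coeff f:] \<noteq> Pinf"
    using assms(1) by (intro nu_const_finite) auto
  then obtain c where "\<nu> (hasse (degree f) f) = Fin c"
    unfolding hasse_degree by (cases "\<nu> [:lead_coeff f:]") auto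
  then have "qmul (1 / of_nat (degree f)) (a - c) \<in> S"
    unfolding S_def using assms(1) by (auto simp: Suc_le_eq)
  then have "S \<noteq> {}" by auto
  with fin have "e \<in> S"
    unfolding e_def by (rule Max_in)
  then obtain s b where sb: "e = qmul (1 / of_nat s) (a - b)" "1 \<le> s" "\<nu> (hasse s f) = Fin b"
    unfolding S_def by blast
  then have "nmul s e = a - b"
    using nmul_qmul_inverse[OF divisible, of s] by simp
  with sb have att: "\<nu> (hasse s f) = Fin (a - nmul s e)" by simp
  have "Fin (a - nmul s e) \<le> \<nu> (hasse s f)" if "1 \<le> s" for s
  proof (cases "\<nu> (hasse s f)")
    case (Fin b)
    then have "qmul (1 / of_nat s) (a - b) \<in> S"
      unfolding S_def using that by auto
    then have "qmul (1 / of_nat s) (a - b) \<le> e"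
      unfolding e_def using fin by simp
    then have "a - b \<le> nmul s e"
      using nmul_mono[of _ e s] nmul_qmul_inverse[OF divisible, of s] that
      by (metis One_nat_def Suc_le_eq)
    with Fin show ?thesis by (simp add: algebra_simps)
  qed simp_all
  with lev att sb(2) show thesis using that by blast
qed

definition KP :: "nat \<Rightarrow> 'k poly \<Rightarrow> 'g \<Rightarrow> bool" where
  "KP m Q \<gamma> \<longleftrightarrow> 0 < m \<and> key_poly \<nu> Q \<and> degree Q = m \<and> \<nu> Q = Fin \<gamma>"

lemma KP_D:
  assumes "KP m Q \<gamma>"
  shows "degree Q = m" "0 < m" "\<nu> Q = Fin \<gamma>" "Q \<noteq> 0" "lead_coeff Q = 1"
  using assms by (auto simp: KP_def key_poly_def)

text \<open>A nonconstant polynomial of infinite value has level \<open>Pinf\<close>, which is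
  strictly below no level; nonzero constants are finite already for \<open>v\<close>.\<close>

lemma KP_finite:
  assumes "KP m Q \<gamma>" "degree f < m" "f \<noteq> 0"
  obtains a where "\<nu> f = Fin a"
proof (cases "degree f = 0")
  case True
  with assms(3) obtain c where "f = [:c:]" "c \<noteq> 0"
    by (metis degree_eq_zeroE pCons_0_0)
  then show ?thesis
    using nu_const_finite[of c] that by (cases "\<nu> f") auto
next
  case False
  then have "level \<nu> f < level \<nu> Q"
    using assms by (auto simp: KP_def key_poly_def)
  then have "\<nu> f \<noteq> Pinf"
    by (auto simp: level_def)
  then show ?thesis
    using that by (cases "\<nu> f") auto
qed

lemma KP_level:
  assumes "KP m Q \<gamma>"
  obtains e b where "1 \<le> b" "\<nu> (hasse b Q) = Fin (\<gamma> - nmul b e)"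
    "\<And>s. 1 \<le> s \<Longrightarrow> Fin (\<gamma> - nmul s e) \<le> \<nu> (hasse s Q)"
    "\<And>f a s. degree f < m \<Longrightarrow> \<nu> f = Fin a \<Longrightarrow> 1 \<le> s \<Longrightarrow> Fin (a - nmul s e) < \<nu> (hasse s f)"
proof -
  obtain e b where e: "level \<nu> Q = Fin e" "1 \<le> b" "\<nu> (hasse b Q) = Fin (\<gamma> - nmul b e)"
    "\<And>s. 1 \<le> s \<Longrightarrow> Fin (\<gamma> - nmul s e) \<le> \<nu> (hasse s Q)"
    using level_Fin[of Q \<gamma>] KP_D[OF assms] by metis
  have "Fin (a - nmul s e) < \<nu> (hasse s f)"
    if f: "degree f < m" "\<nu> f = Fin a" "1 \<le> s" for f a s
  proof (cases "degree f = 0")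
    case True
    then show ?thesis using f(3) by (simp add: hasse_eq_0)
  next
    case False
    then obtain e' where e': "level \<nu> f = Fin e'"
      "Fin (a - nmul s e') \<le> \<nu> (hasse s f)"
      using level_Fin[of f a] f by (metis gr0I)
    have "level \<nu> f < level \<nu> Q"
      using assms False f by (auto simp: KP_def key_poly_def)
    then have "nmul s e' < nmul s e"
      using e e' f by (intro nmul_strict_mono) auto
    then have "Fin (a - nmul s e) < Fin (a - nmul s e')" by simp
    with e'(2) show ?thesis by order
  qed
  with e that show thesis by blast
qed

text \<open>Apply the Hasse derivative of an order \<open>b\<close> attaining the level \<open>e\<close> of \<open>Q\<close>: it lowers the
  value of \<open>q * Q\<close> by exactly \<open>b e\<close>, but those of \<open>f * g\<close> and of the remainder by strictly less.\<close>

lemma KP_mult_div_greater: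
  assumes Q: "KP m Q \<gamma>" and f: "degree f < m" "f \<noteq> 0" and g: "degree g < m" "g \<noteq> 0"
  shows "\<nu> (f * g) < \<nu> ((f * g) div Q * Q)"
proof -
  note Q' = KP_D[OF Q]
  obtain a where a: "\<nu> f = Fin a" using KP_finite[OF Q f] .
  obtain b where b: "\<nu> g = Fin b" using KP_finite[OF Q g] .
  obtain e s where e: "1 \<le> s" "\<nu> (hasse s Q) = Fin (\<gamma> - nmul s e)"
    "\<And>s. 1 \<le> s \<Longrightarrow> Fin (\<gamma> - nmul s e) \<le> \<nu> (hasse s Q)"
    "\<And>f a s. degree f < m \<Longrightarrow> \<nu> f = Fin a \<Longrightarrow> 1 \<le> s \<Longrightarrow> Fin (a - nmul s e) < \<nu> (hasse s f)"
    using KP_level[OF Q] by metis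
  have weak: "Fin (a - nmul i e) \<le> \<nu> (hasse i f)" if "degree f < m" "\<nu> f = Fin a" for f a i
    using e(4)[OF that, of i] that by (cases i) (auto simp: hasse_0 less_imp_le)
  have weakQ: "Fin (\<gamma> - nmul i e) \<le> \<nu> (hasse i Q)" for i
    using e(3)[of i] Q' by (cases i) (auto simp: hasse_0)
  have split: "x + y - nmul s e = (x - nmul i e) + (y - nmul (s - i) e)" if "i \<le> s" for x y i
    using nmul_add_left[of i "s - i" e] that by simp
  define q r where "q = (f * g) div Q" and "r = (f * g) mod Q"
  have fg: "f * g = q * Q + r" by (simp add: q_def r_def)
  have dq: "degree q < m" "degree r < m"
    using degree_mult_div_less[of f Q g] degree_exp_coeff[of Q "f * g" 0] f g Q'
    by (simp_all add: q_def r_def)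
  show ?thesis
  proof (cases "q = 0")
    case True
    then show ?thesis using a b by (simp add: q_def nu_mult)
  next
    case False
    obtain c where c: "\<nu> q = Fin c" using KP_finite[OF Q dq(1) False] .
    have "Fin (a + b - nmul s e) < \<nu> (hasse i f * hasse (s - i) g)" if "i \<le> s" for i
    proof (cases "i = 0")
      case True
      then show ?thesis
        using nu_mult_greater[OF e(4)[OF g(1) b e(1)] weak[OF f(1) a, of 0]]
        by (simp add: algebra_simps)
    next
      case False
      then show ?thesis
        unfolding split[OF that] using e(4)[OF f(1) a, of i] weak[OF g(1) b]
        by (intro nu_mult_greater) auto
    qed
    then have lhs: "Fin (a + b - nmul s e) < \<nu> (hasse s (f * g))"
      unfolding hasse_mult by (intro nu_sum_greater) auto
    have "Fin (c + \<gamma> - nmul s e) < \<nu> (hasse i q * hasse (s - i) Q)" if "i \<in> {1..s}" for i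
    proof -
      have "i \<le> s" "1 \<le> i" using that by auto
      then show ?thesis
        unfolding split[OF \<open>i \<le> s\<close>]
        using e(4)[OF dq(1) c, of i] weakQ by (intro nu_mult_greater)
    qed
    then have "Fin (c + \<gamma> - nmul s e) < \<nu> (\<Sum>i\<in>{1..s}. hasse i q * hasse (s - i) Q)"
      by (intro nu_sum_greater) auto
    moreover have "hasse s (q * Q) = q * hasse s Q + (\<Sum>i\<in>{1..s}. hasse i q * hasse (s - i) Q)"
      unfolding hasse_mult atMost_atLeast0 by (subst sum.atLeast_Suc_atMost) (auto simp: hasse_0)
    moreover have "\<nu> (q * hasse s Q) = Fin (c + \<gamma> - nmul s e)"
      using c e(2) by (simp add: nu_mult algebra_simps)
    ultimately have qQ: "\<nu> (hasse s (q * Q)) = Fin (c + \<gamma> - nmul s e)"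
      by (simp add: nu_add_eq)
    have sum_eq: "hasse s (q * Q) = hasse s (f * g) - hasse s r"
      by (simp add: fg hasse_add)
    \<comment> \<open>Otherwise \<open>r = f * g - q * Q\<close> has value at least
      \<open>c + \<gamma>\<close>. The derivatives of order \<open>s\<close> of \<open>r\<close> and
      of \<open>f * g\<close> then both have value above \<open>c + \<gamma> - nmul s e\<close>,
      which is the exact value of their difference.\<close>
    have "a + b < c + \<gamma>"
    proof (rule ccontr)
      assume "\<not> a + b < c + \<gamma>"
      then have le: "c + \<gamma> \<le> a + b" by simp
      have "Fin (c + \<gamma>) \<le> \<nu> (f * g - q * Q)"
        using le a b c Q' by (intro nu_diff_ge) (auto simp: nu_mult)
      then have r: "Fin (c + \<gamma>) \<le> \<nu> r" by (simp add: fg)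
      have "Fin (c + \<gamma> - nmul s e) < \<nu> (hasse s r)"
      proof (cases "r = 0")
        case True
        then show ?thesis by (simp add: hasse_def)
      next
        case False
        then obtain d where d: "\<nu> r = Fin d" using KP_finite[OF Q dq(2)] by blast
        with r have "Fin (c + \<gamma> - nmul s e) \<le> Fin (d - nmul s e)" by simp
        with e(4)[OF dq(2) d e(1)] show ?thesis by order
      qed
      moreover have "Fin (c + \<gamma> - nmul s e) < \<nu> (hasse s (f * g))"
      proof -
        have "Fin (c + \<gamma> - nmul s e) \<le> Fin (a + b - nmul s e)" using le by simp
        with lhs show ?thesis by order
      qed
      ultimately have "Fin (c + \<gamma> - nmul s e) < \<nu> (hasse s (q * Q))"
        unfolding sum_eq by (intro nu_diff_greater)
      with qQ show False by simp
    qed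
    then show ?thesis
      using a b c Q' by (simp add: nu_mult flip: q_def)
  qed
qed

lemma KP_mult_mod:
  assumes Q: "KP m Q \<gamma>" and f: "degree f < m" and g: "degree g < m"
  shows "\<nu> ((f * g) mod Q) = \<nu> (f * g)"
proof (cases "f = 0 \<or> g = 0")
  case True
  then show ?thesis by auto
next
  case False
  then have "\<nu> (f * g) < \<nu> (- ((f * g) div Q * Q))"
    using KP_mult_div_greater[OF assms(1)] f g by (simp del: mult_minus_left)
  then have "\<nu> (f * g + - ((f * g) div Q * Q)) = \<nu> (f * g)"
    by (rule nu_add_eq)
  then show ?thesis
    by (simp add: minus_div_mult_eq_mod)
qed

lemma KP_mult_div_ge:
  assumes Q: "KP m Q \<gamma>" and f: "degree f < m" "Fin a \<le> \<nu> f" and g: "degree g < m" "Fin b \<le> \<nu> g"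
  shows "Fin (a + b - \<gamma>) \<le> \<nu> ((f * g) div Q)"
proof (cases "f = 0 \<or> g = 0")
  case True
  then show ?thesis by auto
next
  case False
  then have "\<nu> (f * g) < \<nu> ((f * g) div Q) + Fin \<gamma>"
    using KP_mult_div_greater[OF assms(1)] f g KP_D[OF Q] by (simp add: nu_mult)
  moreover have "Fin (a + b) \<le> \<nu> (f * g)"
    using f g by (intro nu_mult_ge)
  ultimately show ?thesis
    unfolding Fin_le_diff_cancel by order
qed


section \<open>Truncations\<close>

text \<open>The bound \<open>\<nu>\<^sub>Q(f) \<ge> c\<close> when \<open>\<gamma> = \<nu>(Q)\<close>, but \<open>Q\<close> may also be given a smaller weight \<open>\<gamma>\<close>.\<close>

definition expge :: "'k poly \<Rightarrow> 'g \<Rightarrow> 'g \<Rightarrow> 'k poly \<Rightarrow> bool" where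
  "expge Q \<gamma> c f \<longleftrightarrow> (\<forall>i. Fin (c - nmul i \<gamma>) \<le> \<nu> (exp_coeff Q f i))"

lemma expge_add: "expge Q \<gamma> c f \<Longrightarrow> expge Q \<gamma> c g \<Longrightarrow> expge Q \<gamma> c (f + g)"
  by (simp add: expge_def exp_coeff_add nu_add_ge)

lemma expge_diff: "expge Q \<gamma> c f \<Longrightarrow> expge Q \<gamma> c g \<Longrightarrow> expge Q \<gamma> c (f - g)"
  by (simp add: expge_def exp_coeff_diff nu_diff_ge)

lemma expge_small: "degree f < degree Q \<Longrightarrow> expge Q \<gamma> c f \<longleftrightarrow> Fin c \<le> \<nu> f"
  unfolding expge_def by (auto simp: exp_coeff_small dest: spec[of _ 0])

lemma expge_mult_self:
  assumes "Q \<noteq> 0" "expge Q \<gamma> c f"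
  shows "expge Q \<gamma> (c + \<gamma>) (Q * f)"
  unfolding expge_def
proof
  fix i
  show "Fin (c + \<gamma> - nmul i \<gamma>) \<le> \<nu> (exp_coeff Q (Q * f) i)"
    using assms by (cases i) (auto simp: expge_def exp_coeff_mult_self)
qed

lemma expge_div:
  assumes "expge Q \<gamma> c f"
  shows "expge Q \<gamma> (c - \<gamma>) (f div Q)"
  unfolding expge_def
proof
  fix i
  show "Fin (c - \<gamma> - nmul i \<gamma>) \<le> \<nu> (exp_coeff Q (f div Q) i)"
    using assms[unfolded expge_def, rule_format, of "Suc i"] by (simp add: algebra_simps)
qed

lemma expge_mod: "expge Q \<gamma> c f \<Longrightarrow> Fin c \<le> \<nu> (f mod Q)"
  unfolding expge_def by (auto dest: spec[of _ 0])

lemma expge_mono_slope: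
  assumes "expge Q \<gamma> c f" "\<gamma> \<le> \<gamma>'"
  shows "expge Q \<gamma>' c f"
  unfolding expge_def
proof
  fix i
  have "c - nmul i \<gamma>' \<le> c - nmul i \<gamma>" using assms(2) by (simp add: nmul_mono)
  then show "Fin (c - nmul i \<gamma>') \<le> \<nu> (exp_coeff Q f i)"
    using assms(1) Fin_le_trans unfolding expge_def by blast
qed

lemma expge_mono:
  assumes "expge Q \<gamma> c f" "c' \<le> c"
  shows "expge Q \<gamma> c' f"
  unfolding expge_def
proof
  fix i
  have "c' - nmul i \<gamma> \<le> c - nmul i \<gamma>" using assms(2) by (rule diff_right_mono)
  then show "Fin (c' - nmul i \<gamma>) \<le> \<nu> (exp_coeff Q f i)"
    using assms(1) Fin_le_trans unfolding expge_def by blast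
qed

lemma expge_imp_nu_ge:
  assumes "KP m Q \<gamma>" "expge Q \<gamma> c f"
  shows "Fin c \<le> \<nu> f"
  using assms(2)
proof (induction "degree f" arbitrary: f c rule: less_induct)
  case less
  note Q = KP_D[OF assms(1)]
  show ?case
  proof (cases "degree f < m")
    case True
    then show ?thesis using less.prems expge_small[of f Q] Q by simp
  next
    case False
    then have "Fin (c - \<gamma>) \<le> \<nu> (f div Q)"
      using Q by (intro less.hyps[OF degree_div_less] expge_div less.prems) auto
    then have "Fin (\<gamma> + (c - \<gamma>)) \<le> \<nu> (Q * (f div Q))"
      using Q by (intro nu_mult_ge) auto
    then have "Fin c \<le> \<nu> (Q * (f div Q) + f mod Q)"
      using less.prems by (intro nu_add_ge) (auto intro: expge_mod)
    then show ?thesis by simp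
  qed
qed

text \<open>Reduction modulo \<open>Q\<close> preserves the value of a product of two digits. A
  carry loses at most \<open>\<gamma>\<close>, but it moves to the next power of \<open>Q\<close>,
  whose additional weight is this same \<open>\<gamma>\<close>.\<close>

lemma expge_mult_small:
  assumes Q: "KP m Q \<gamma>" and a: "degree a < m" "Fin x \<le> \<nu> a" and h: "expge Q \<gamma> c h"
  shows "expge Q \<gamma> (x + c) (a * h)"
  unfolding expge_def
proof
  fix i
  note Q' = KP_D[OF Q]
  have d: "degree (exp_coeff Q h i) < m" for i
    using Q' degree_exp_coeff[of Q] by simp
  have hi: "Fin (c - nmul i \<gamma>) \<le> \<nu> (exp_coeff Q h i)" for i
    using h by (simp add: expge_def)
  have md: "Fin (x + c - nmul i \<gamma>) \<le> \<nu> ((a * exp_coeff Q h i) mod Q)" for i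
    using KP_mult_mod[OF Q a(1) d] nu_mult_ge[OF a(2) hi] by (simp add: algebra_simps)
  show "Fin (x + c - nmul i \<gamma>) \<le> \<nu> (exp_coeff Q (a * h) i)"
  proof (cases i)
    case 0
    then show ?thesis using md[of 0] by (simp add: mod_mult_right_eq)
  next
    case (Suc l)
    have "Fin (x + (c - nmul l \<gamma>) - \<gamma>) \<le> \<nu> ((a * exp_coeff Q h l) div Q)"
      using KP_mult_div_ge[OF Q a d hi] .
    then have "Fin (x + c - nmul i \<gamma>) \<le> \<nu> ((a * exp_coeff Q h l) div Q)"
      by (simp add: Suc algebra_simps)
    then show ?thesis
      using md[of i] Q' a(1) unfolding Suc
      by (subst exp_coeff_mult_small) (auto intro: nu_add_ge)
  qed
qed

section \<open>Change of the key polynomial used for expansions\<close>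

lemma KP_diff:
  assumes "KP m P \<gamma>" "KP m Q \<gamma>'" "\<gamma> < \<gamma>'"
  shows "degree (Q - P) < m" "\<nu> (Q - P) = Fin \<gamma>"
proof -
  note P = KP_D[OF assms(1)] and Q = KP_D[OF assms(2)]
  show "degree (Q - P) < m"
  proof (rule degree_lessI)
    show "Q - P \<noteq> 0 \<or> 0 < m" using P by auto
    show "\<forall>k\<ge>m. coeff (Q - P) k = 0"
      using P Q by (metis coeff_diff coeff_eq_0 diff_self le_neq_implies_less)
  qed
  have "\<nu> (- P + Q) = Fin \<gamma>"
    using nu_add_eq[of "- P" Q] P Q assms(3) by simp
  then show "\<nu> (Q - P) = Fin \<gamma>" by simp
qed

text \<open>The two truncations below agree, since \<open>Q\<close> and \<open>P\<close> differ by an element of value \<open>\<gamma>\<close>.\<close>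

lemma expge_change_up:
  assumes P: "KP m P \<gamma>" and Q: "KP m Q \<gamma>'" and "\<gamma> < \<gamma>'" and "expge P \<gamma> c f"
  shows "expge Q \<gamma> c f"
  using assms(4)
proof (induction "degree f" arbitrary: f c rule: less_induct)
  case less
  note P' = KP_D[OF P] and Q' = KP_D[OF Q]
  define a where "a = Q - P"
  have a: "degree a < m" "\<nu> a = Fin \<gamma>"
    using KP_diff[OF P Q assms(3)] by (simp_all add: a_def)
  show ?case
  proof (cases "degree f < m")
    case True
    then show ?thesis using less.prems expge_small[of f] P' Q' by simp
  next
    case False
    define h where "h = f div P"
    have dh: "degree h + m = degree f"
      using False P' by (simp add: h_def degree_div_poly)
    have h: "expge P \<gamma> (c - \<gamma>) h"
      unfolding h_def by (rule expge_div[OF less.prems])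
    have "expge Q \<gamma> (c - \<gamma>) h"
      using less.hyps[OF _ h] dh P' by simp
    then have 1: "expge Q \<gamma> c (Q * h)"
      using expge_mult_self[of Q] Q' by fastforce
    have "expge P \<gamma> c (a * h)"
      using expge_mult_small[OF P a(1) _ h, of \<gamma>] a by simp
    \<comment> \<open>This drop in degree lets the induction hypothesis re-expand
      \<open>a * h\<close>, and not only \<open>h\<close>, in powers of \<open>Q\<close>.\<close>
    moreover have "degree (a * h) < degree f"
      using degree_mult_le[of a h] a dh by simp
    ultimately have 2: "expge Q \<gamma> c (a * h)"
      using less.hyps by blast
    have "degree (f mod P) < degree Q"
      using degree_exp_coeff[of P f 0] P' Q' by simp
    then have 3: "expge Q \<gamma> c (f mod P)"
      using expge_small expge_mod[OF less.prems] by blast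
    have "f = P * h + f mod P" by (simp add: h_def)
    then have "f = (Q * h - a * h) + f mod P" by (simp add: a_def algebra_simps)
    then show ?thesis
      using expge_add[OF expge_diff[OF 1 2] 3] by simp
  qed
qed

text \<open>Here \<open>f\<close> is divided by \<open>Q\<close> and \<open>Q = P + a\<close> is
  substituted, so the product with \<open>a\<close> is bounded directly in terms of
  \<open>P\<close>, without a second appeal to the induction hypothesis.\<close>

lemma expge_change_down:
  assumes P: "KP m P \<gamma>" and Q: "KP m Q \<gamma>'" and "\<gamma> < \<gamma>'" and "expge Q \<gamma> c f"
  shows "expge P \<gamma> c f"
  using assms(4)
proof (induction "degree f" arbitrary: f c rule: less_induct)
  case less
  note P' = KP_D[OF P] and Q' = KP_D[OF Q]
  define a where "a = Q - P"
  have a: "degree a < m" "\<nu> a = Fin \<gamma>"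
    using KP_diff[OF P Q assms(3)] by (simp_all add: a_def)
  show ?case
  proof (cases "degree f < m")
    case True
    then show ?thesis using less.prems expge_small[of f] P' Q' by simp
  next
    case False
    define h where "h = f div Q"
    have dh: "degree h + m = degree f"
      using False Q' by (simp add: h_def degree_div_poly)
    have "expge Q \<gamma> (c - \<gamma>) h"
      unfolding h_def by (rule expge_div[OF less.prems])
    then have h: "expge P \<gamma> (c - \<gamma>) h"
      using less.hyps dh P' by simp
    have 1: "expge P \<gamma> c (P * h)"
      using expge_mult_self[OF _ h] P' by fastforce
    have 2: "expge P \<gamma> c (a * h)"
      using expge_mult_small[OF P a(1) _ h, of \<gamma>] a by simp
    have "degree (f mod Q) < degree P"
      using degree_exp_coeff[of Q f 0] P' Q' by simp
    then have 3: "expge P \<gamma> c (f mod Q)"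
      using expge_small expge_mod[OF less.prems] by blast
    have "f = Q * h + f mod Q" by (simp add: h_def)
    then have "f = (P * h + a * h) + f mod Q" by (simp add: a_def algebra_simps)
    then show ?thesis
      using expge_add[OF expge_add[OF 1 2] 3] by simp
  qed
qed

lemma exp_coeff_eq_0_degree:
  assumes "KP m Q \<gamma>" "degree f < i"
  shows "exp_coeff Q f i = 0"
proof (rule exp_coeff_eq_0)
  have "i * 1 \<le> i * degree Q" using KP_D[OF assms(1)] by (intro mult_le_mono2) simp
  with assms(2) show "degree f < i * degree Q" by linarith
qed

lemma le_nuQ_iff:
  assumes "KP m Q \<gamma>"
  shows "Fin c \<le> nuQ \<nu> Q f \<longleftrightarrow> expge Q \<gamma> c f"
proof -
  note Q = KP_D[OF assms]
  have "Fin c \<le> nuQ \<nu> Q f \<longleftrightarrow> (\<forall>i\<le>degree f. Fin c \<le> \<nu> (exp_coeff Q f i * Q ^ i))"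
    unfolding nuQ_def by (subst Min_ge_iff) auto
  also have "\<dots> \<longleftrightarrow> (\<forall>i\<le>degree f. Fin (c - nmul i \<gamma>) \<le> \<nu> (exp_coeff Q f i))"
    by (simp add: nu_mult nu_power[OF Q(3)] Fin_le_diff_cancel)
  also have "\<dots> \<longleftrightarrow> expge Q \<gamma> c f"
    unfolding expge_def using exp_coeff_eq_0_degree[OF assms] by (metis le_Pinf not_less nu_0)
  finally show ?thesis .
qed

lemma exp_coeff_all_0:
  assumes "KP m Q \<gamma>" "\<And>i. exp_coeff Q f i = 0"
  shows "f = 0"
  using assms(2)
proof (induction "degree f" arbitrary: f rule: less_induct)
  case less
  note Q = KP_D[OF assms(1)]
  show ?case
  proof (cases "degree f < m")
    case True
    then show ?thesis using less.prems[of 0] Q by (simp add: mod_poly_less)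
  next
    case False
    have "exp_coeff Q (f div Q) i = 0" for i
      using less.prems[of "Suc i"] by simp
    moreover have "degree (f div Q) < degree f"
      using Q False by (intro degree_div_less) auto
    ultimately have "f div Q = 0"
      using less.hyps by blast
    then show ?thesis
      using less.prems[of 0] div_mult_mod_eq[of f Q] by simp
  qed
qed

text \<open>Some coefficient is nonzero and, having degree below \<open>m\<close>, of finite value.
  This includes \<open>f\<close> with \<open>\<nu> f = Pinf\<close>.\<close>

lemma nuQ_finite:
  assumes Q: "KP m Q \<gamma>" and "f \<noteq> 0"
  obtains c where "nuQ \<nu> Q f = Fin c"
proof (cases "nuQ \<nu> Q f")
  case Pinf
  have "exp_coeff Q f i = 0" for i
  proof (cases "i \<le> degree f")
    case True
    then have "nuQ \<nu> Q f \<le> \<nu> (exp_coeff Q f i * Q ^ i)"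
      unfolding nuQ_def by (intro Min_le) auto
    then have "\<nu> (exp_coeff Q f i) = Pinf"
      using Pinf KP_D[OF Q] by (cases "\<nu> (exp_coeff Q f i)") (auto simp: nu_mult nu_power)
    moreover have "degree (exp_coeff Q f i) < m"
      using degree_exp_coeff[of Q f i] KP_D[OF Q] by simp
    ultimately show ?thesis
      using KP_finite[OF Q] by (metis extended.distinct(1))
  qed (use exp_coeff_eq_0_degree[OF Q] in auto)
  then show ?thesis using exp_coeff_all_0[OF Q] \<open>f \<noteq> 0\<close> by blast
next
  case Minf
  have "nuQ \<nu> Q f \<in> (\<lambda>i. \<nu> (exp_coeff Q f i * Q ^ i)) ` {..degree f}"
    unfolding nuQ_def by (intro Min_in) auto
  with Minf show ?thesis by (metis imageE nu_not_Minf)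
qed

lemma nuQ_le_nu:
  assumes "KP m Q \<gamma>"
  shows "nuQ \<nu> Q f \<le> \<nu> f"
proof (cases "f = 0")
  case False
  then obtain c where c: "nuQ \<nu> Q f = Fin c" using nuQ_finite[OF assms] by blast
  then show ?thesis using le_nuQ_iff[OF assms, of c f] expge_imp_nu_ge[OF assms, of c f] by simp
qed simp

text \<open>The error of replacing the coefficient \<open>F\<^sub>Q\<^sub>,\<^sub>l\<close> by the residue modulo \<open>Q\<close> of the formal
  derivative in \<open>Q0\<close>. It stems from the carries in products of two polynomials of degree below
  \<open>m\<close>; bounding these by means of a third key polynomial \<open>P\<close> gains \<open>\<gamma>Q - \<gamma>P\<close>.\<close>

lemma exp_coeff_exp_deriv:
  assumes P: "KP m P \<gamma>P" and Q0: "KP m Q0 \<gamma>0" and Q: "KP m Q \<gamma>Q"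
    and lt: "\<gamma>P < \<gamma>0" "\<gamma>0 < \<gamma>Q"
    and "expge Q0 \<gamma>0 c f"
  shows "Fin (c + (\<gamma>Q - \<gamma>P) - nmul l \<gamma>Q) \<le> \<nu> (exp_coeff Q f l - exp_deriv Q0 l f mod Q)"
  using assms(6)
proof (induction "degree f" arbitrary: f c l rule: less_induct)
  case (less f c l')
  note P' = KP_D[OF P] and Q0' = KP_D[OF Q0] and Q' = KP_D[OF Q]
  define a where "a = Q - Q0"
  have a: "degree a < m" "\<nu> a = Fin \<gamma>0"
    using KP_diff[OF Q0 Q lt(2)] by (simp_all add: a_def)
  show ?case
  proof (cases l')
    case 0
    then show ?thesis by simp
  next
    case (Suc l)
    show ?thesis
    proof (cases "degree f < m")
      case True
      then show ?thesis using Q' Q0' by (simp add: Suc exp_coeff_small exp_deriv_Suc_small del: exp_coeff.simps)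
    next
      case False
      define h where "h = f div Q0"
      have dh: "degree h < degree f"
        using False Q0' by (simp add: h_def degree_div_less)
      have h: "expge Q0 \<gamma>0 (c - \<gamma>0) h"
        unfolding h_def by (rule expge_div[OF less.prems])
      define E where "E l = exp_coeff Q h l - exp_deriv Q0 l h mod Q" for l
      have E: "Fin (c - \<gamma>0 + (\<gamma>Q - \<gamma>P) - nmul l \<gamma>Q) \<le> \<nu> (E l)" for l
        unfolding E_def by (rule less.hyps[OF dh h])
      have dE: "degree (E l) < m" for l
      proof -
        have "degree (exp_deriv Q0 l h mod Q) < m" "degree (exp_coeff Q h l) < m"
          using degree_exp_coeff[of Q "exp_deriv Q0 l h" 0] degree_exp_coeff[of Q h] Q' by simp_all
        then show ?thesis
          unfolding E_def using degree_diff_le_max[of "exp_coeff Q h l" "exp_deriv Q0 l h mod Q"] by simp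
      qed
      define q where "q = (a * exp_coeff Q h l) div Q"
      have dhl: "degree (exp_coeff Q h l) < m"
        using degree_exp_coeff[of Q h] Q' by simp
      have f: "f = (Q * h - a * h) + f mod Q0"
        by (simp add: a_def h_def algebra_simps)
      have "degree (f mod Q0) < degree Q"
        using degree_exp_coeff[of Q0 f 0] Q0' Q' by simp
      then have "exp_coeff Q f l' = exp_coeff Q h l - exp_coeff Q (a * h) l'"
        using Q'(4) unfolding Suc
        by (subst f) (simp only: exp_coeff_add exp_coeff_diff exp_coeff_mult_self exp_coeff_small, simp)
      also have "exp_coeff Q (a * h) l' = (a * exp_coeff Q h l') mod Q + q"
        unfolding Suc q_def using a Q' by (intro exp_coeff_mult_small) simp
      finally have 1: "exp_coeff Q f l' = exp_coeff Q h l - (a * exp_coeff Q h l') mod Q - q"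
        by simp
      have "exp_deriv Q0 l' f mod Q = (Q0 * exp_deriv Q0 l' h + exp_deriv Q0 l h) mod Q"
        using Q0' by (simp add: Suc exp_deriv_Suc[of Q0 l f] h_def)
      also have "Q0 * exp_deriv Q0 l' h = Q * exp_deriv Q0 l' h - a * exp_deriv Q0 l' h"
        by (simp add: a_def algebra_simps)
      finally have 2: "exp_deriv Q0 l' f mod Q = exp_deriv Q0 l h mod Q - (a * (exp_deriv Q0 l' h mod Q)) mod Q"
        by (simp add: poly_mod_add_left poly_mod_diff_left mod_mult_right_eq)
      \<comment> \<open>The recursions for coefficient and derivative differ only by the carry
        \<open>q\<close>, so the errors satisfy the same recursion with \<open>q\<close> as the new
        source term.\<close>
      have eq: "exp_coeff Q f l' - exp_deriv Q0 l' f mod Q = E l - (a * E l') mod Q - q"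
        unfolding 1 2 E_def by (simp add: right_diff_distrib poly_mod_diff_left)
      have "Fin (c + (\<gamma>Q - \<gamma>P) - nmul l' \<gamma>Q) \<le> \<nu> (E l)"
        using E[of l] by (rule Fin_le_trans) (use lt(2) in \<open>simp add: Suc algebra_simps\<close>)
      moreover have "Fin (c + (\<gamma>Q - \<gamma>P) - nmul l' \<gamma>Q) \<le> \<nu> ((a * E l') mod Q)"
        unfolding KP_mult_mod[OF Q a(1) dE]
        using nu_mult_ge[OF _ E[of l'], of \<gamma>0 a] a by (simp add: algebra_simps)
      moreover have "Fin (c + (\<gamma>Q - \<gamma>P) - nmul l' \<gamma>Q) \<le> \<nu> q"
      proof -
        have "expge Q \<gamma>0 (c - \<gamma>0) h"
          by (rule expge_change_up[OF Q0 Q lt(2) h])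
        then have "Fin (c - \<gamma>0 - nmul l \<gamma>0) \<le> \<nu> (exp_coeff Q h l)"
          by (simp add: expge_def)
        \<comment> \<open>Bounding the product first in powers of \<open>P\<close>, then in powers
          of \<open>Q\<close> with weight \<open>\<gamma>P\<close>, makes the division by
          \<open>Q\<close> cost only \<open>\<gamma>P\<close>. This is the source of the gain
          \<open>\<gamma>Q - \<gamma>P\<close>.\<close>
        then have "expge P \<gamma>P (c - \<gamma>0 - nmul l \<gamma>0) (exp_coeff Q h l)"
          using dhl P' by (subst expge_small) auto
        then have "expge P \<gamma>P (\<gamma>0 + (c - \<gamma>0 - nmul l \<gamma>0)) (a * exp_coeff Q h l)"
          using a by (intro expge_mult_small[OF P]) auto
        then have "expge Q \<gamma>P (\<gamma>0 + (c - \<gamma>0 - nmul l \<gamma>0)) (a * exp_coeff Q h l)"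
          using lt by (rule_tac expge_change_up[OF P Q]) auto
        then have "Fin (\<gamma>0 + (c - \<gamma>0 - nmul l \<gamma>0) - \<gamma>P) \<le> \<nu> (q mod Q)"
          unfolding q_def by (rule expge_mod[OF expge_div])
        moreover have "q mod Q = q"
          unfolding q_def using a dhl Q' by (intro mod_poly_less degree_mult_div_less) auto
        ultimately have "Fin (c - nmul l \<gamma>0 - \<gamma>P) \<le> \<nu> q" by (simp add: algebra_simps)
        then show ?thesis
        proof (rule Fin_le_trans)
          show "c + (\<gamma>Q - \<gamma>P) - nmul l' \<gamma>Q \<le> c - nmul l \<gamma>0 - \<gamma>P"
            using nmul_mono[of \<gamma>0 \<gamma>Q l] lt(2) by (simp add: Suc algebra_simps)
        qed
      qed
      ultimately show ?thesis
        unfolding eq by (intro nu_diff_ge)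
    qed
  qed
qed

end

section \<open>Values of polynomials of small degree\<close>

text \<open>The space is spanned by \<open>m\<close> monomials, while injectivity gives
  \<open>m + 1\<close> distinct vectors. Injectivity also turns a relation on the image of
  \<open>p\<close> into one indexed by \<open>i\<close>.\<close>

lemma poly_linear_dependence:
  fixes p :: "nat \<Rightarrow> 'k::field poly"
  assumes "\<And>i. degree (p i) < m" and "inj_on p {..m}"
  obtains c where "\<exists>i\<le>m. c i \<noteq> 0" "(\<Sum>i\<le>m. smult (c i) (p i)) = 0"
proof -
  interpret P: vector_space "smult :: 'k \<Rightarrow> 'k poly \<Rightarrow> 'k poly"
    by unfold_locales (auto simp: smult_add_right smult_add_left)
  let ?T = "(\<lambda>i. monom 1 i) ` {..<m} :: 'k poly set"
  have "p i \<in> P.span ?T" for i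
  proof -
    have "p i = (\<Sum>j\<le>degree (p i). smult (coeff (p i) j) (monom 1 j))"
      by (simp add: poly_as_sum_of_monoms smult_monom)
    also have "\<dots> \<in> P.span ?T"
      using assms(1)[of i] by (intro P.span_sum P.span_scale P.span_base) auto
    finally show ?thesis .
  qed
  then have "p ` {..m} \<subseteq> P.span ?T" by auto
  moreover have "card ?T \<le> m"
    using card_image_le[of "{..<m}" "\<lambda>i. monom (1::'k) i"] by simp
  moreover have "card (p ` {..m}) = Suc m"
    using assms(2) by (simp add: card_image)
  ultimately have "P.dependent (p ` {..m})"
    using P.independent_span_bound[of ?T "p ` {..m}"] by fastforce
  then obtain u where u: "\<exists>x\<in>p ` {..m}. u x \<noteq> 0" "(\<Sum>x\<in>p ` {..m}. smult (u x) x) = 0"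
    using P.dependent_finite[of "p ` {..m}"] by auto
  then show thesis
    using assms(2) by (intro that[of "u \<circ> p"]) (auto simp: sum.reindex)
qed

context poly_val
begin

text \<open>Used contrapositively: a vanishing nonempty sum of terms of finite value contains two
  terms of equal value.\<close>

lemma nu_sum_distinct:
  assumes "finite I" "I \<noteq> {}" "\<And>i. i \<in> I \<Longrightarrow> \<nu> (t i) \<noteq> Pinf" "inj_on (\<lambda>i. \<nu> (t i)) I"
  shows "\<exists>i\<in>I. \<nu> (sum t I) = \<nu> (t i)"
  using assms
proof (induction I rule: finite_ne_induct)
  case (insert i I)
  then obtain j where j: "j \<in> I" "\<nu> (sum t I) = \<nu> (t j)" by auto
  with insert have "\<nu> (t i) \<noteq> \<nu> (sum t I)" by (auto simp: image_iff)
  then consider "\<nu> (t i) < \<nu> (sum t I)" | "\<nu> (sum t I) < \<nu> (t i)" by fastforce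
  then have "\<nu> (t i + sum t I) = \<nu> (t i) \<or> \<nu> (t i + sum t I) = \<nu> (sum t I)"
    using nu_add_eq[of "t i" "sum t I"] nu_add_eq[of "sum t I" "t i"] by cases (auto simp: add.commute)
  then show ?case using insert j by auto
qed simp

section \<open>The value group and its divisible hull\<close>

lemma value_group_diff:
  assumes "x \<in> value_group v" "y \<in> value_group v"
  shows "x - y \<in> value_group v"
proof -
  obtain a b where ab: "a \<noteq> 0" "v a = Fin x" "b \<noteq> 0" "v b = Fin y"
    using assms by (auto simp: value_group_def)
  have mult: "v (c * d) = v c + v d" for c d
    using fv by (simp add: field_valuation_def)
  have "v (a / b) + Fin y = Fin x"
    using mult[of "a / b" b] ab by simp
  then have "v (a / b) = Fin (x - y)"
    by (cases "v (a / b)") (auto simp: algebra_simps)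
  then show ?thesis
    using ab unfolding value_group_def by (intro CollectI exI[of _ "a / b"]) auto
qed

lemma value_group_0: "0 \<in> value_group v"
  unfolding value_group_def using nu_1 nu_const[of 1] by (auto intro!: exI[of _ 1] simp: one_pCons)

lemma value_group_add:
  "x \<in> value_group v \<Longrightarrow> y \<in> value_group v \<Longrightarrow> x + y \<in> value_group v"
  using value_group_diff[of x "0 - y"] value_group_diff[of 0 y] value_group_0 by simp

lemma value_group_nmul: "x \<in> value_group v \<Longrightarrow> nmul n x \<in> value_group v"
  by (induction n) (auto simp: value_group_0 value_group_add)

lemma div_hull_add:
  assumes "x \<in> div_hull v" "y \<in> div_hull v"
  shows "x + y \<in> div_hull v"
proof -
  obtain i j where ij: "0 < i" "nmul i x \<in> value_group v" "0 < j" "nmul j y \<in> value_group v"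
    using assms by (auto simp: div_hull_def)
  have "nmul (i * j) (x + y) = nmul j (nmul i x) + nmul i (nmul j y)"
    by (simp add: nmul_add flip: nmul_mult) (simp add: mult.commute)
  then have "nmul (i * j) (x + y) \<in> value_group v"
    using ij by (simp add: value_group_add value_group_nmul)
  then show ?thesis
    unfolding div_hull_def using ij by (intro CollectI exI[of _ "i * j"]) simp
qed

lemma div_hull_nmul: "x \<in> div_hull v \<Longrightarrow> nmul n x \<in> div_hull v"
proof (induction n)
  case 0
  then show ?case
    unfolding div_hull_def using value_group_0 by (intro CollectI exI[of _ 1]) simp
qed (auto intro: div_hull_add)

text \<open>Multiplication modulo \<open>Q\<close> makes \<open>\<nu>\<close> a valuation on the \<open>m\<close>-dimensional space of
  polynomials of degree below \<open>m\<close>. A linear relation between the powers of \<open>f\<close> in this space has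
  two terms of the same value.\<close>

lemma KP_value_in_hull:
  assumes Q: "KP m Q \<gamma>" and f: "degree f < m" "\<nu> f = Fin a"
  shows "a \<in> div_hull v"
proof (cases "a = 0")
  case True
  then show ?thesis
    unfolding div_hull_def using value_group_0 by (intro CollectI exI[of _ 1]) simp
next
  case False
  note Q' = KP_D[OF Q]
  define p where "p i = f ^ i mod Q" for i
  have dp: "degree (p i) < m" for i
    using degree_exp_coeff[of Q "f ^ i" 0] Q' by (simp add: p_def)
  have vp: "\<nu> (p i) = Fin (nmul i a)" for i
  proof (induction i)
    case 0
    then show ?case using Q' by (simp add: p_def mod_poly_less)
  next
    case (Suc i)
    have "p (Suc i) = (f * p i) mod Q"
      by (simp add: p_def mod_mult_right_eq)
    then show ?case
      using KP_mult_mod[OF Q f(1) dp] Suc f by (simp add: nu_mult)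
  qed
  \<comment> \<open>As \<open>a\<close> is nonzero in a torsion-free group, its multiples are
    distinct, and hence so are the \<open>p i\<close>.\<close>
  have dist: "nmul i a \<noteq> nmul j a" if "i < j" for i j
  proof
    assume "nmul i a = nmul j a"
    then have "nmul (j - i) a = nmul (j - i) 0"
      using nmul_add_left[of i "j - i" a] that by simp
    then show False using that False nmul_inject[of "j - i" a 0] by simp
  qed
  have "inj_on p {..m}"
  proof (rule inj_onI)
    fix i j assume "p i = p j"
    then have "nmul i a = nmul j a" using vp by (metis extended.inject)
    then show "i = j" using dist by (metis nat_neq_iff)
  qed
  from poly_linear_dependence[OF dp this]
  obtain c where c: "\<exists>i\<le>m. c i \<noteq> 0" "(\<Sum>i\<le>m. smult (c i) (p i)) = 0" .
  \<comment> \<open>Terms with zero coefficient are discarded because their value is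
    infinite.\<close>
  define I where "I = {i. i \<le> m \<and> c i \<noteq> 0}"
  define t where "t i = smult (c i) (p i)" for i
  have I: "finite I" "I \<noteq> {}" using c(1) by (auto simp: I_def)
  have "sum t I = (\<Sum>i\<le>m. t i)"
    by (rule sum.mono_neutral_left) (auto simp: I_def t_def)
  then have "sum t I = 0" using c(2) by (simp add: t_def)
  have vt: "\<nu> (t i) = v (c i) + Fin (nmul i a)" for i
    using nu_mult[of "[:c i:]" "p i"] vp by (simp add: t_def nu_const)
  have "\<nu> (t i) \<noteq> Pinf" if "i \<in> I" for i
    using that nu_const_finite[of "c i"] unfolding vt nu_const I_def by (cases "v (c i)") auto
  then have "\<not> inj_on (\<lambda>i. \<nu> (t i)) I"
    using nu_sum_distinct[OF I, of t] \<open>sum t I = 0\<close> by fastforce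
  then have "\<exists>i\<in>I. \<exists>j\<in>I. i < j \<and> \<nu> (t i) = \<nu> (t j)"
    unfolding inj_on_def by (metis nat_neq_iff)
  then obtain i j where ij: "i \<in> I" "j \<in> I" "i < j" "\<nu> (t i) = \<nu> (t j)" by blast
  obtain x y where xy: "v (c i) = Fin x" "v (c j) = Fin y"
    using ij fv by (cases "v (c i)"; cases "v (c j)") (auto simp: I_def field_valuation_def)
  then have "x + nmul i a = y + nmul j a" using ij vt by simp
  then have "nmul (j - i) a = x - y"
    using nmul_add_left[of i "j - i" a] ij(3) by (simp add: algebra_simps)
  moreover have "x - y \<in> value_group v"
    using ij xy by (intro value_group_diff) (auto simp: value_group_def I_def)
  ultimately show ?thesis
    unfolding div_hull_def using ij(3) by (intro CollectI exI[of _ "j - i"]) simp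
qed

end

section \<open>Families of key polynomials without last element\<close>

locale key_family = poly_val v \<nu>
  for v :: "'k::field \<Rightarrow> 'g::linordered_ab_group_add extended" and \<nu> +
  fixes m :: nat and QQ :: "'k poly set"
  assumes m_pos: "0 < m"
    and QQ_sub: "QQ \<subseteq> Psi \<nu> m"
    and QQ_ne: "QQ \<noteq> {}"
    and QQ_inj: "inj_on \<nu> QQ"
    and QQ_unbounded: "\<And>Q. Q \<in> QQ \<Longrightarrow> \<exists>R\<in>QQ. \<nu> Q < \<nu> R"
begin

definition gam :: "'k poly \<Rightarrow> 'g" where
  "gam Q = (case \<nu> Q of Fin x \<Rightarrow> x | _ \<Rightarrow> 0)"

text \<open>No member can exceed an infinite value, so the default \<open>0\<close> in
  \<open>gam\<close> is never taken on \<open>QQ\<close>.\<close>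

lemma nu_gam: "Q \<in> QQ \<Longrightarrow> \<nu> Q = Fin (gam Q)"
  using QQ_unbounded[of Q] by (cases "\<nu> Q") (auto simp: gam_def)

lemma KP_gam: "Q \<in> QQ \<Longrightarrow> KP m Q (gam Q)"
  using QQ_sub m_pos nu_gam by (auto simp: KP_def Psi_def)

lemma gam_unbounded: "Q \<in> QQ \<Longrightarrow> \<exists>R\<in>QQ. gam Q < gam R"
  using QQ_unbounded[of Q] nu_gam by (metis less_extended_simps(1))

text \<open>For a later \<open>R\<close> this is also the value of \<open>R - Q\<close>, a
  polynomial of degree below \<open>m\<close>.\<close>

lemma gam_in_hull: "Q \<in> QQ \<Longrightarrow> gam Q \<in> div_hull v"
  using gam_unbounded[of Q] KP_diff[OF KP_gam KP_gam] KP_value_in_hull[OF KP_gam] by metis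

lemma eventually_Q_iff:
  "eventually_Q \<nu> QQ P \<longleftrightarrow> (\<exists>Q0\<in>QQ. \<forall>Q\<in>QQ. gam Q0 \<le> gam Q \<longrightarrow> P Q)"
  unfolding eventually_Q_def using nu_gam by (metis less_eq_extended.simps(1))

lemma eventually_Q_greater: "Q0 \<in> QQ \<Longrightarrow> eventually_Q \<nu> QQ (\<lambda>Q. gam Q0 < gam Q)"
  unfolding eventually_Q_iff using gam_unbounded[of Q0] by (meson order_less_le_trans)

lemma eventually_Q_conj:
  assumes "eventually_Q \<nu> QQ P" "eventually_Q \<nu> QQ P'"
  shows "eventually_Q \<nu> QQ (\<lambda>Q. P Q \<and> P' Q)"
proof -
  obtain Q R where "Q \<in> QQ" "\<And>S. S \<in> QQ \<Longrightarrow> gam Q \<le> gam S \<Longrightarrow> P S"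
    "R \<in> QQ" "\<And>S. S \<in> QQ \<Longrightarrow> gam R \<le> gam S \<Longrightarrow> P' S"
    using assms unfolding eventually_Q_iff by blast
  then show ?thesis
    unfolding eventually_Q_iff by (cases "gam Q \<le> gam R") (meson order_trans linear)+
qed

section \<open>Growth of truncations along the family, and stability\<close>

lemma nuQ_mono:
  assumes "Q \<in> QQ" "R \<in> QQ" "gam Q \<le> gam R"
  shows "nuQ \<nu> Q f \<le> nuQ \<nu> R f"
proof (cases "f = 0 \<or> gam Q = gam R")
  case True
  then show ?thesis
    using inj_onD[OF QQ_inj, of Q R] assms nu_gam by (auto simp: nuQ_def)
next
  case False
  then obtain c where c: "nuQ \<nu> Q f = Fin c" using nuQ_finite[OF KP_gam] assms by blast
  then have "expge Q (gam Q) c f" using le_nuQ_iff[OF KP_gam, of Q c f] assms by simp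
  then have "expge R (gam Q) c f"
    using False assms expge_change_up[OF KP_gam[OF assms(1)] KP_gam[OF assms(2)]] by auto
  then have "expge R (gam R) c f"
    using assms(3) by (rule expge_mono_slope)
  then show ?thesis
    using c le_nuQ_iff[OF KP_gam, of R c f] assms by simp
qed

text \<open>Only exponents up to \<open>degree f div m\<close> occur in the expansion in
  \<open>R\<close>, so lowering the weight of \<open>R\<close> to \<open>gam Q\<close> costs at most
  that many times the difference of weights.\<close>

lemma nuQ_growth:
  assumes "Q \<in> QQ" "R \<in> QQ" "gam Q < gam R" "Fin c \<le> nuQ \<nu> R f"
  shows "Fin (c - nmul (degree f div m) (gam R - gam Q)) \<le> nuQ \<nu> Q f"
proof -
  let ?d = "gam R - gam Q" and ?D = "degree f div m"
  have R: "expge R (gam R) c f" using assms le_nuQ_iff[OF KP_gam] by blast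
  have "expge R (gam Q) (c - nmul ?D ?d) f"
    unfolding expge_def
  proof
    fix i
    show "Fin (c - nmul ?D ?d - nmul i (gam Q)) \<le> \<nu> (exp_coeff R f i)"
    proof (cases "i \<le> ?D")
      case True
      have "nmul i ?d \<le> nmul ?D ?d"
        using True assms(3) by (intro nmul_mono_left) auto
      then have "c - nmul ?D ?d - nmul i (gam Q) \<le> c - nmul i (gam R)"
        by (simp add: nmul_diff algebra_simps)
      then show ?thesis
        using R Fin_le_trans unfolding expge_def by blast
    next
      case False
      then have "degree f < i * m"
        using m_pos by (simp add: div_less_iff_less_mult not_le)
      then have "exp_coeff R f i = 0"
        using KP_D(1)[OF KP_gam[OF assms(2)]] by (intro exp_coeff_eq_0) simp
      then show ?thesis by simp
    qed
  qed
  then have "expge Q (gam Q) (c - nmul ?D ?d) f"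
    by (rule expge_change_down[OF KP_gam[OF assms(1)] KP_gam[OF assms(2)] assms(3)])
  then show ?thesis using assms le_nuQ_iff[OF KP_gam] by blast
qed

text \<open>Truncations increase with \<open>Q\<close> and are bounded by \<open>\<nu>\<close>, so
  equality at one \<open>Q\<close> would persist and give stability.\<close>

lemma unstable_nuQ_less:
  assumes "\<not> Q_stable \<nu> QQ f" "Q \<in> QQ"
  shows "nuQ \<nu> Q f < \<nu> f"
proof (rule ccontr)
  assume "\<not> nuQ \<nu> Q f < \<nu> f"
  then have "nuQ \<nu> R f = \<nu> f" if "R \<in> QQ" "gam Q \<le> gam R" for R
    using nuQ_le_nu[OF KP_gam[OF that(1)], of f] nuQ_mono[OF assms(2) that, of f] by order
  then show False
    using assms unfolding Q_stable_def eventually_Q_iff by blast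
qed

text \<open>Past a stable \<open>Q\<close>, the quotient by \<open>R\<close> is bounded using the
  weight \<open>gam Q\<close>, while multiplying back by \<open>R\<close> adds \<open>gam R\<close>.
  The quotient part thus lies strictly above \<open>\<nu> f\<close>.\<close>

lemma stable_mod:
  assumes "Q_stable \<nu> QQ f"
  shows "eventually_Q \<nu> QQ (\<lambda>Q. \<nu> (f mod Q) = \<nu> f)"
proof (cases "f = 0")
  case True
  then show ?thesis using QQ_ne by (auto simp: eventually_Q_def)
next
  case False
  obtain Q where Q: "Q \<in> QQ" "nuQ \<nu> Q f = \<nu> f"
    using assms unfolding Q_stable_def eventually_Q_def by blast
  obtain c where c: "nuQ \<nu> Q f = Fin c" using nuQ_finite[OF KP_gam[OF Q(1)] False] .
  have "\<nu> (f mod R) = \<nu> f" if R: "R \<in> QQ" "gam Q < gam R" for R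
  proof -
    have "expge Q (gam Q) c f" using c le_nuQ_iff[OF KP_gam, of Q c f] Q by simp
    then have "expge R (gam Q) c f"
      by (rule expge_change_up[OF KP_gam[OF Q(1)] KP_gam[OF R(1)] R(2)])
    then have "expge R (gam Q) (c - gam Q) (f div R)"
      by (rule expge_div)
    then have "expge R (gam R) (c - gam Q) (f div R)"
      using R(2) by (rule expge_mono_slope[OF _ less_imp_le])
    then have "Fin (c - gam Q) \<le> \<nu> (f div R)"
      by (rule expge_imp_nu_ge[OF KP_gam[OF R(1)]])
    then have "Fin (c - gam Q + gam R) \<le> \<nu> (f div R * R)"
      using nu_gam[OF R(1)] by (intro nu_mult_ge) auto
    moreover have "Fin c < Fin (c - gam Q + gam R)"
      using R by (simp add: algebra_simps)
    ultimately have "Fin c < \<nu> (f div R * R)" by order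
    then have "\<nu> f < \<nu> (- (f div R * R))"
      using c Q by (simp del: mult_minus_left)
    then have "\<nu> (f + - (f div R * R)) = \<nu> f" by (rule nu_add_eq)
    then show ?thesis by (simp add: minus_div_mult_eq_mod)
  qed
  then show ?thesis
    using eventually_Q_greater[OF Q(1)] unfolding eventually_Q_def by blast
qed

section \<open>Terms of the expansion compared with the cut\<close>

lemma above_deltaL_greater:
  assumes "above_deltaL v \<nu> QQ F x" "F \<noteq> 0" "R \<in> QQ"
  shows "nuQ \<nu> R F < x"
proof -
  obtain c where "nuQ \<nu> R F = Fin c" using nuQ_finite[OF KP_gam] assms by blast
  then show ?thesis
    using assms by (auto simp: above_deltaL_def deltaL_def)
qed

lemma zero_in_B:
  assumes "F \<in> KP_inf \<nu> QQ"
  shows "0 \<in> B_set v \<nu> m QQ F"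
proof (rule ccontr)
  assume "0 \<notin> B_set v \<nu> m QQ F"
  then have "eventually_Q \<nu> QQ (\<lambda>Q. above_deltaL v \<nu> QQ F (\<nu> (F mod Q)))"
    by (simp add: B_set_def J_set_def)
  then obtain Q where Q: "Q \<in> QQ" "above_deltaL v \<nu> QQ F (\<nu> (F mod Q))"
    unfolding eventually_Q_def by blast
  note Q' = KP_D[OF KP_gam[OF Q(1)]]
  have F: "F \<noteq> 0" "\<not> Q_stable \<nu> QQ F" "\<And>g. degree g < degree F \<Longrightarrow> Q_stable \<nu> QQ g"
    using assms by (auto simp: KP_inf_def not_le[symmetric])
  have "degree Q \<le> degree F"
  proof (rule ccontr)
    assume "\<not> degree Q \<le> degree F"
    then have lt: "degree F < m" using Q' by simp
    obtain c where c: "\<nu> F = Fin c" using KP_finite[OF KP_gam[OF Q(1)] lt F(1)] .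
    then have "Fin c \<le> nuQ \<nu> Q F"
      using le_nuQ_iff[OF KP_gam[OF Q(1)]] expge_small[of F Q] lt Q' by simp
    then show False using unstable_nuQ_less[OF F(2) Q(1)] c by simp
  qed
  define G where "G = F div Q"
  have FG: "F = Q * G + F mod Q" by (simp add: G_def)
  have "degree G < degree F"
    unfolding G_def using Q' \<open>degree Q \<le> degree F\<close> by (intro degree_div_less) auto
  then have "eventually_Q \<nu> QQ (\<lambda>R. nuQ \<nu> R G = \<nu> G)"
    using F(3) by (simp add: Q_stable_def)
  then have "eventually_Q \<nu> QQ (\<lambda>R. nuQ \<nu> R G = \<nu> G \<and> gam Q < gam R)"
    using eventually_Q_greater[OF Q(1)] by (rule eventually_Q_conj)
  then obtain R where R: "R \<in> QQ" "nuQ \<nu> R G = \<nu> G" "gam Q < gam R"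
    unfolding eventually_Q_def by blast
  note KR = KP_gam[OF R(1)]
  obtain c where c: "nuQ \<nu> R F = Fin c" using nuQ_finite[OF KR F(1)] .
  have "G \<noteq> 0"
    using FG \<open>degree Q \<le> degree F\<close> degree_exp_coeff[of Q F 0] Q'
    by (metis add_0 exp_coeff.simps(1) mult_zero_right not_less)
  then obtain d where d: "\<nu> G = Fin d" using nuQ_finite[OF KR] R(2) by metis
  have r: "Fin c < \<nu> (F mod Q)"
    using above_deltaL_greater[OF Q(2) F(1) R(1)] c by simp
  have "Fin c < \<nu> (F - F mod Q)"
    using unstable_nuQ_less[OF F(2) R(1)] r c by (intro nu_diff_greater) auto
  moreover have "F - F mod Q = Q * G"
    using FG by (metis add_diff_cancel_right')
  ultimately have lt: "c < gam Q + d"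
    using Q' d by (simp add: nu_mult)
  \<comment> \<open>A group element \<open>c'\<close> is needed as a bound in \<open>expge\<close>,
    although \<open>\<nu> (F mod Q)\<close> may be infinite.\<close>
  have "\<exists>c'>c. Fin c' \<le> \<nu> (F mod Q) \<and> c' \<le> gam Q + d"
  proof (cases "\<nu> (F mod Q)")
    case (Fin x)
    then show ?thesis using lt r by (intro exI[of _ "min x (gam Q + d)"]) auto
  qed (use lt in auto)
  then obtain c' where c': "c < c'" "Fin c' \<le> \<nu> (F mod Q)" "c' \<le> gam Q + d" by blast
  have G: "expge R (gam R) d G" using le_nuQ_iff[OF KR, of d G] R(2) d by simp
  have 1: "expge R (gam R) c' (R * G)"
  proof (rule expge_mono)
    show "expge R (gam R) (d + gam R) (R * G)"
      by (rule expge_mult_self[OF KP_D(4)[OF KR] G])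
    have "gam Q + d \<le> d + gam R" using R(3) by (simp add: add.commute)
    then show "c' \<le> d + gam R" using c'(3) by order
  qed
  have 2: "expge R (gam R) c' ((R - Q) * G)"
    using expge_mult_small[OF KR _ _ G, of "R - Q" "gam Q"]
      KP_diff[OF KP_gam[OF Q(1)] KR R(3)] expge_mono[OF _ c'(3)] by auto
  have "degree (F mod Q) < degree R"
    using degree_exp_coeff[of Q F 0] Q' KP_D[OF KR] by simp
  then have 3: "expge R (gam R) c' (F mod Q)"
    using c'(2) expge_small by blast
  \<comment> \<open>Writing \<open>Q = R - (R - Q)\<close> yields three terms whose truncations at
    \<open>R\<close> are all at least \<open>c'\<close>, because \<open>G\<close> already attains
    its true value there.\<close>
  have "F = R * G - (R - Q) * G + F mod Q"
    by (subst FG) (simp add: algebra_simps)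
  then have "expge R (gam R) c' F"
    using expge_add[OF expge_diff[OF 1 2] 3] by simp
  then have "Fin c' \<le> nuQ \<nu> R F" using le_nuQ_iff[OF KR] by blast
  then show False using c c' by simp
qed

text \<open>With ratio \<open>(n + 1) / n\<close>, boundedness from \<open>gam P\<close> reads
  \<open>nmul n (gam R - gam P) < nmul (Suc n) (gam Q - gam P)\<close>; subtracting
  \<open>nmul n (gam Q - gam P)\<close> gives the claim.\<close>

lemma vert_bounded_gap:
  assumes "vert_bounded (gammaL v \<nu> QQ)" "P \<in> QQ" "0 < n"
  obtains Q where "Q \<in> QQ" "gam P < gam Q"
    "\<And>R. R \<in> QQ \<Longrightarrow> nmul n (gam R - gam Q) < gam Q - gam P"
proof -
  let ?L = "gammaL v \<nu> QQ" and ?q = "of_nat (Suc n) / of_nat n :: rat"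
  have L: "gam R \<in> ?L" if "R \<in> QQ" for R
    using that gam_in_hull nu_gam by (auto simp: gammaL_def)
  have "1 < ?q" using assms(3) by (simp add: field_simps)
  then obtain y where y: "y \<in> ?L" "\<And>z. z \<in> ?L \<Longrightarrow> z - gam P < qmul ?q (y - gam P)"
    using assms(1) L[OF assms(2)] unfolding vert_bounded_def by blast
  \<comment> \<open>The witness \<open>y\<close> is only in the initial segment; enlarging it to a
    value \<open>gam Q\<close> preserves the bound.\<close>
  then obtain Q where Q: "Q \<in> QQ" "y \<le> gam Q"
    using nu_gam by (auto simp: gammaL_def)
  have bound: "nmul n (gam R - gam P) < nmul (Suc n) (gam Q - gam P)" if "R \<in> QQ" for R
  proof -
    have "nmul n (gam R - gam P) < nmul n (qmul ?q (y - gam P))"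
      using y(2)[OF L[OF that]] assms(3) by (rule nmul_strict_mono)
    also have "\<dots> = nmul (Suc n) (y - gam P)"
      by (rule nmul_qmul_Suc[OF divisible assms(3)])
    also have "\<dots> \<le> nmul (Suc n) (gam Q - gam P)"
      using Q by (intro nmul_mono) simp
    finally show ?thesis .
  qed
  show thesis
  proof (rule that[OF Q(1)])
    show "gam P < gam Q"
    proof (rule ccontr)
      assume "\<not> gam P < gam Q"
      then have "nmul (Suc n) (gam Q - gam P) \<le> nmul (Suc n) 0"
        by (intro nmul_mono) simp
      then show False using bound[OF assms(2)] by (simp del: nmul.simps(2))
    qed
    show "nmul n (gam R - gam Q) < gam Q - gam P" if "R \<in> QQ" for R
    proof -
      define x y where "x = gam R - gam P" and "y = gam Q - gam P"
      have "gam R - gam Q = x - y" by (simp add: x_def y_def)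
      moreover have "nmul n x < y + nmul n y"
        using bound[OF that] by (simp add: x_def y_def)
      ultimately show ?thesis
        by (simp add: nmul_diff diff_less_eq flip: y_def)
    qed
  qed
qed

lemma exp_coeff_ult_constant:
  assumes F: "F \<in> KP_inf \<nu> QQ" and vb: "vert_bounded (gammaL v \<nu> QQ)"
    and l: "l \<in> B_set v \<nu> m QQ F" "0 < l"
  shows "ult_constant \<nu> QQ (\<lambda>Q. \<nu> (exp_coeff Q F l))"
proof -
  have F': "F \<noteq> 0" "\<And>g. degree g < degree F \<Longrightarrow> Q_stable \<nu> QQ g"
    using F by (auto simp: KP_inf_def not_le[symmetric])
  define n where "n = degree F div m"
  have "0 < n" using l by (auto simp: B_set_def n_def)
  obtain P where P: "P \<in> QQ" using QQ_ne by blast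
  obtain Q0 where Q0: "Q0 \<in> QQ" "gam P < gam Q0"
    "\<And>R. R \<in> QQ \<Longrightarrow> nmul n (gam R - gam Q0) < gam Q0 - gam P"
    using vert_bounded_gap[OF vb P \<open>0 < n\<close>] by blast
  note Q0' = KP_D[OF KP_gam[OF Q0(1)]]
  obtain c where c: "nuQ \<nu> Q0 F = Fin c" using nuQ_finite[OF KP_gam[OF Q0(1)] F'(1)] .
  then have ec: "expge Q0 (gam Q0) c F" using le_nuQ_iff[OF KP_gam[OF Q0(1)], of c F] by simp
  define D where "D = exp_deriv Q0 l F"
  have "Q_stable \<nu> QQ D"
  proof (cases "D = 0")
    case True
    then show ?thesis using QQ_ne by (auto simp: Q_stable_def eventually_Q_def nuQ_def)
  next
    case False
    then have "degree D < degree F"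
      using degree_exp_deriv[of Q0 "l - 1" F] l(2) Q0' by (simp add: D_def)
    then show ?thesis by (rule F'(2))
  qed
  then have "eventually_Q \<nu> QQ (\<lambda>Q. \<nu> (D mod Q) = \<nu> D \<and> gam Q0 < gam Q)"
    using stable_mod eventually_Q_greater[OF Q0(1)] by (intro eventually_Q_conj)
  then obtain Q1 where Q1: "Q1 \<in> QQ"
    "\<And>Q. Q \<in> QQ \<Longrightarrow> gam Q1 \<le> gam Q \<Longrightarrow> \<nu> (D mod Q) = \<nu> D \<and> gam Q0 < gam Q"
    unfolding eventually_Q_iff by blast
  \<comment> \<open>The error beats every truncation of \<open>F\<close>, with \<open>R\<close>
    independent of \<open>Q\<close>: by the choice of \<open>Q0\<close>, the growth of truncations
    beyond \<open>Q0\<close> stays below the gain from the carries.\<close>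
  have err: "nuQ \<nu> R F < \<nu> (exp_coeff Q F l - D mod Q) + Fin (nmul l (gam Q))"
    if Q: "Q \<in> QQ" "gam Q0 < gam Q" and R: "R \<in> QQ" for Q R
  proof -
    have "Fin (c + (gam Q - gam P)) \<le> \<nu> (exp_coeff Q F l - D mod Q) + Fin (nmul l (gam Q))"
      using exp_coeff_exp_deriv[OF KP_gam[OF P] KP_gam[OF Q0(1)] KP_gam[OF Q(1)] Q0(2) Q(2) ec]
      unfolding D_def Fin_le_diff_cancel .
    moreover have "nuQ \<nu> R F < Fin (c + (gam Q - gam P))"
    proof (cases "gam R \<le> gam Q0")
      case True
      then have "nuQ \<nu> R F \<le> Fin c" using nuQ_mono[OF R Q0(1)] c by metis
      moreover have "Fin c < Fin (c + (gam Q - gam P))" using Q Q0(2) by simp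
      ultimately show ?thesis by order
    next
      case False
      obtain d where d: "nuQ \<nu> R F = Fin d" using nuQ_finite[OF KP_gam[OF R] F'(1)] .
      then have "d - nmul n (gam R - gam Q0) \<le> c"
        using nuQ_growth[OF Q0(1) R, of d F] False c by (simp add: n_def)
      then have "d \<le> c + nmul n (gam R - gam Q0)" by (simp add: algebra_simps)
      also have "\<dots> < c + (gam Q0 - gam P)" using Q0(3)[OF R] by simp
      also have "\<dots> < c + (gam Q - gam P)" using Q(2) by simp
      finally show ?thesis using d by simp
    qed
    ultimately show ?thesis by order
  qed
  have "\<nu> (exp_coeff Q F l) = \<nu> D" if Q: "Q \<in> QQ" "gam Q1 \<le> gam Q" for Q
  proof -
    \<comment> \<open>Membership in \<open>B_set\<close> controls the term only at some later
      \<open>S\<close>. There it identifies \<open>\<nu> D\<close>, which no longer depends on the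
      key polynomial, and the result is brought back to \<open>Q\<close>.\<close>
    have "\<not> eventually_Q \<nu> QQ
      (\<lambda>Q. above_deltaL v \<nu> QQ F (\<nu> (exp_coeff Q F l) + nmul l (\<nu> Q)))"
      using l by (auto simp: B_set_def J_set_def)
    then obtain S where S: "S \<in> QQ" "gam Q \<le> gam S"
      "\<not> above_deltaL v \<nu> QQ F (\<nu> (exp_coeff S F l) + Fin (nmul l (gam S)))"
      using Q(1) nu_gam nmul_Fin unfolding eventually_Q_iff by metis
    then obtain x where x: "\<nu> (exp_coeff S F l) = Fin x"
      by (cases "\<nu> (exp_coeff S F l)") (auto simp: above_deltaL_def)
    have "degree (exp_coeff S F l) < m"
      using KP_D[OF KP_gam[OF S(1)]] degree_exp_coeff[of S F l] by simp
    then have "x \<in> div_hull v"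
      using KP_value_in_hull[OF KP_gam[OF S(1)]] x by blast
    then have "x + nmul l (gam S) \<in> div_hull v"
      using gam_in_hull[OF S(1)] by (intro div_hull_add div_hull_nmul)
    \<comment> \<open>A term in the divisible hull that is not above the cut lies in
      \<open>deltaL\<close>, hence below some truncation of \<open>F\<close>.\<close>
    then obtain R where R: "R \<in> QQ" "Fin (x + nmul l (gam S)) \<le> nuQ \<nu> R F"
      using S(3) x by (auto simp: above_deltaL_def deltaL_def)
    have S1: "\<nu> (D mod S) = \<nu> D" "gam Q0 < gam S"
      using Q1(2)[OF S(1)] Q S(2) by auto
    have "Fin (x + nmul l (gam S)) < \<nu> (exp_coeff S F l - D mod S) + Fin (nmul l (gam S))"
      using err[OF S(1) S1(2) R(1)] R(2) by order
    then have "Fin x < \<nu> (- (exp_coeff S F l - D mod S))"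
      unfolding nu_minus by (cases "\<nu> (exp_coeff S F l - D mod S)") auto
    then have "\<nu> (exp_coeff S F l + - (exp_coeff S F l - D mod S)) = Fin x"
      using x nu_add_eq by metis
    then have D: "\<nu> D = Fin x" using S1(1) by simp
    \<comment> \<open>Since \<open>gam Q \<le> gam S\<close>, the same truncation at
      \<open>R\<close> also dominates \<open>x\<close> plus the weight at \<open>Q\<close>, so the
      error at \<open>Q\<close> is too small to alter the value \<open>x\<close> of
      \<open>D mod Q\<close>.\<close>
    have "Fin (x + nmul l (gam Q)) \<le> Fin (x + nmul l (gam S))"
      using nmul_mono[OF S(2)] by simp
    then have "Fin (x + nmul l (gam Q)) < \<nu> (exp_coeff Q F l - D mod Q) + Fin (nmul l (gam Q))"
      using err[OF Q(1) conjunct2[OF Q1(2)[OF Q]] R(1)] R(2) by order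
    then have "Fin x < \<nu> (exp_coeff Q F l - D mod Q)"
      by (cases "\<nu> (exp_coeff Q F l - D mod Q)") auto
    then have "\<nu> (D mod Q + (exp_coeff Q F l - D mod Q)) = \<nu> D"
      using nu_add_eq[of "D mod Q"] Q1(2)[OF Q] D by metis
    then show ?thesis by simp
  qed
  then show ?thesis
    unfolding ult_constant_def eventually_Q_iff using Q1(1) by blast
qed

end

theorem mainTheorem7:
  fixes v :: "'k::field \<Rightarrow> 'g::linordered_ab_group_add extended"
    and \<nu> :: "'k poly \<Rightarrow> 'g extended"
    and m :: nat and QQ :: "'k poly set" and F :: "'k poly"
  assumes "divisible_group TYPE('g)"
    and "field_valuation v"
    and "poly_valuation v \<nu>"
    and "well_specified v \<nu>"
    and "1 \<le> m"
    and "Psi \<nu> m \<noteq> {}"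
    and "\<forall>P\<in>Psi \<nu> m. \<exists>R\<in>Psi \<nu> m. \<nu> P < \<nu> R"
    and "QQ \<subseteq> Psi \<nu> m"
    and "inj_on \<nu> QQ"
    and "wf {(Q, R). Q \<in> QQ \<and> R \<in> QQ \<and> \<nu> Q < \<nu> R}"
    and "\<forall>P\<in>Psi \<nu> m. \<exists>Q\<in>QQ. \<nu> P \<le> \<nu> Q"
    and "F \<in> KP_inf \<nu> QQ"
    and "vert_bounded (gammaL v \<nu> QQ)"
  shows "B_set v \<nu> m QQ F = {0} \<union> Bct_set v \<nu> m QQ F"
proof -
  interpret key_family v \<nu> m QQ
  proof
    \<comment> \<open>A key polynomial of larger value exists in \<open>Psi \<nu> m\<close>, and
      cofinality replaces it by a member of \<open>QQ\<close>.\<close>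
    show "\<exists>R\<in>QQ. \<nu> Q < \<nu> R" if "Q \<in> QQ" for Q
      using assms(7,8,11) that by (meson order_less_le_trans subsetD)
  qed (use assms in auto)
  show ?thesis
    using zero_in_B[OF assms(12)] exp_coeff_ult_constant[OF assms(12,13)]
    by (auto simp: Bct_set_def)
qed

end
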